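(* Let $\Omega_x$, $\Omega_t$, $\mu$, $f$ satisfy the standing assumptions given in the context, and for $t\in\Omega_t$ let $u(\cdot,t)\in H_0^1(\Omega_x)$ be the weak solution of $-\Delta u(\cdot,t)+\mu(\cdot,t)u(\cdot,t)=f(\cdot,t)$ in $\Omega_x$, $u(\cdot,t)=0$ on $\partial\Omega_x$. Then the solution mapping $t\mapsto u(\cdot,t)$ belongs to $C^k(\Omega_t;H_0^1(\Omega_x))$ for any integer $k\ge 0$. Moreover, for all multi-indices $\alpha$ with $|\alpha|\le k$ and all $t^{(1)},t^{(2)}\in\Omega_t$, $$\bigl\|\partial_t^{\alpha}u(\cdot,t^{(1)})-\partial_t^{\alpha}u(\cdot,t^{(2)})\bigr\|_{H_0^1(\Omega_x)}\le C_\alpha\,\|t^{(1)}-t^{(2)}\|_{\mathbb R^{N_t}},$$ where $C_\alpha$ depends only on the bounds $\mu_{\min},\mu_{\max}$, the coefficient functions $\mu_i$, the domain geometry, and the affine coefficients $f_i$.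
   Context: Setting. $d\in\{2,3\}$, $N_t\ge 1$ is an integer, $\Omega_t=[0,1]^{N_t}$, $\mathcal O=\Omega_x\times\Omega_t$. $\Delta$ acts in $x$; $\partial_t^\alpha$ denotes derivatives in $t$ for multi-indices $\alpha\in\mathbb N_0^{N_t}$. Standing assumptions. (1) $\Omega_x\subset\mathbb R^d$ is either a convex polygonal/polyhedral domain or a bounded $C^{1,1}$ domain. (2) $\mu(x,t)=\mu_0(x)+\sum_{i=1}^{N_t}t_i\mu_i(x)$ with $\mu_i\in L^\infty(\Omega_x)$ for $i=0,\dots,N_t$, and there are constants $0<\mu_{\min}\le\mu_{\max}<\infty$ with $\mu_{\min}\le\mu(x,t)\le\mu_{\max}$ for a.e. $(x,t)\in\mathcal O$. (3) $f(x,t)=f_0(x)+\sum_{i=1}^{N_t}t_i f_i(x)$ with $f_i\in H^{-1}(\Omega_x)$ for $i=0,\dots,N_t$. The weak solution means: $\int_{\Omega_x}\nabla u(\cdot,t)\cdot\nabla v\,dx+\int_{\Omega_x}\mu(\cdot,t)u(\cdot,t)v\,dx=\langle f(\cdot,t),v\rangle_{H^{-1}(\Omega_x)\times H_0^1(\Omega_x)}$ for all $v\in H_0^1(\Omega_x)$. *)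

theory Defs
  imports "HOL-Analysis.Analysis"
begin

section \<open>The Hilbert space of square-integrable functions\<close>

definition square_integrable :: "('a::euclidean_space \<Rightarrow> 'b::euclidean_space) \<Rightarrow> bool" where
  "square_integrable f \<longleftrightarrow>
     f \<in> borel_measurable lebesgue \<and> integrable lebesgue (\<lambda>x. (norm (f x))\<^sup>2)"

definition l2_eq :: "('a::euclidean_space \<Rightarrow> 'b::euclidean_space) \<Rightarrow> ('a \<Rightarrow> 'b) \<Rightarrow> bool" where
  "l2_eq f g \<longleftrightarrow> square_integrable f \<and> square_integrable g \<and> (AE x in lebesgue. f x = g x)"

lemma square_integrable_zero: "square_integrable (\<lambda>_. 0)"
  by (simp add: square_integrable_def)

lemma square_integrable_scaleR:
  assumes "square_integrable f" shows "square_integrable (\<lambda>x. c *\<^sub>R f x)"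
  using assms unfolding square_integrable_def
  by (auto simp: power_mult_distrib)

lemma square_integrable_inner:
  assumes f: "square_integrable f" and g: "square_integrable g"
  shows "integrable lebesgue (\<lambda>x. f x \<bullet> g x)"
proof (rule Bochner_Integration.integrable_bound)
  show "integrable lebesgue (\<lambda>x. (norm (f x))\<^sup>2 + (norm (g x))\<^sup>2)"
    using f g by (auto simp: square_integrable_def)
  show "(\<lambda>x. f x \<bullet> g x) \<in> borel_measurable lebesgue"
    using f g by (auto simp: square_integrable_def intro: borel_measurable_inner)
  have "\<bar>a \<bullet> b\<bar> \<le> (norm a)\<^sup>2 + (norm b)\<^sup>2" for a b :: 'b
  proof -
    have "2 * (norm a * norm b) \<le> (norm a)\<^sup>2 + (norm b)\<^sup>2"
      using sum_squares_bound[of "norm a" "norm b"] by simp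
    moreover have "0 \<le> norm a * norm b" by simp
    ultimately show ?thesis using Cauchy_Schwarz_ineq2[of a b] by linarith
  qed
  then show "AE x in lebesgue. norm (f x \<bullet> g x) \<le> norm ((norm (f x))\<^sup>2 + (norm (g x))\<^sup>2)"
    by simp
qed

lemma square_integrable_add:
  assumes f: "square_integrable f" and g: "square_integrable g"
  shows "square_integrable (\<lambda>x. f x + g x)"
proof -
  have "integrable lebesgue (\<lambda>x. (norm (f x))\<^sup>2 + 2 * (f x \<bullet> g x) + (norm (g x))\<^sup>2)"
    using f g square_integrable_inner[OF f g] by (auto simp: square_integrable_def)
  moreover have "(norm (f x + g x))\<^sup>2 = (norm (f x))\<^sup>2 + 2 * (f x \<bullet> g x) + (norm (g x))\<^sup>2" for x
    by (simp add: power2_norm_eq_inner inner_add inner_commute)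
  ultimately show ?thesis
    using f g by (auto simp: square_integrable_def)
qed

lemma square_integrable_uminus:
  "square_integrable f \<Longrightarrow> square_integrable (\<lambda>x. - f x)"
  using square_integrable_scaleR[of f "-1"] by simp

lemma square_integrable_diff:
  "square_integrable f \<Longrightarrow> square_integrable g \<Longrightarrow> square_integrable (\<lambda>x. f x - g x)"
  using square_integrable_add[of f "\<lambda>x. - g x"] square_integrable_uminus[of g] by simp

lemma part_equivp_l2_eq:
  "part_equivp (l2_eq :: ('a::euclidean_space \<Rightarrow> 'b::euclidean_space) \<Rightarrow> _)"
proof (rule part_equivpI)
  show "\<exists>f :: 'a \<Rightarrow> 'b. l2_eq f f"
    by (rule exI[of _ "\<lambda>_. 0"]) (simp add: l2_eq_def square_integrable_zero)
  show "symp (l2_eq :: ('a \<Rightarrow> 'b) \<Rightarrow> _)"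
    by (auto simp: symp_def l2_eq_def elim: eventually_mono)
  show "transp (l2_eq :: ('a \<Rightarrow> 'b) \<Rightarrow> _)"
  proof (rule transpI)
    fix f g h :: "'a \<Rightarrow> 'b"
    assume *: "l2_eq f g" "l2_eq g h"
    then have "AE x in lebesgue. f x = g x" "AE x in lebesgue. g x = h x"
      by (auto simp: l2_eq_def)
    then have "AE x in lebesgue. f x = h x"
      by eventually_elim simp
    with * show "l2_eq f h"
      by (simp add: l2_eq_def)
  qed
qed

quotient_type (overloaded) ('a, 'b) l2 =
    "'a::euclidean_space \<Rightarrow> 'b::euclidean_space" / partial: l2_eq
  by (rule part_equivp_l2_eq)

instantiation l2 :: (euclidean_space, euclidean_space) real_inner
begin

lift_definition zero_l2 :: "('a, 'b) l2" is "\<lambda>_. 0"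
  by (simp add: l2_eq_def square_integrable_zero)

lift_definition plus_l2 :: "('a, 'b) l2 \<Rightarrow> ('a, 'b) l2 \<Rightarrow> ('a, 'b) l2" is "\<lambda>f g x. f x + g x"
  by (auto simp: l2_eq_def square_integrable_add elim: eventually_elim2)

lift_definition minus_l2 :: "('a, 'b) l2 \<Rightarrow> ('a, 'b) l2 \<Rightarrow> ('a, 'b) l2" is "\<lambda>f g x. f x - g x"
  by (auto simp: l2_eq_def square_integrable_diff elim: eventually_elim2)

lift_definition uminus_l2 :: "('a, 'b) l2 \<Rightarrow> ('a, 'b) l2" is "\<lambda>f x. - f x"
  by (auto simp: l2_eq_def square_integrable_uminus elim: eventually_mono)

lift_definition scaleR_l2 :: "real \<Rightarrow> ('a, 'b) l2 \<Rightarrow> ('a, 'b) l2" is "\<lambda>c f x. c *\<^sub>R f x"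
  by (auto simp: l2_eq_def square_integrable_scaleR elim: eventually_mono)

lift_definition inner_l2 :: "('a, 'b) l2 \<Rightarrow> ('a, 'b) l2 \<Rightarrow> real"
  is "\<lambda>f g. \<integral>x. f x \<bullet> g x \<partial>lebesgue"
proof -
  fix f f' g g' :: "'a \<Rightarrow> 'b"
  assume *: "l2_eq f f'" "l2_eq g g'"
  show "(\<integral>x. f x \<bullet> g x \<partial>lebesgue) = (\<integral>x. f' x \<bullet> g' x \<partial>lebesgue)"
  proof (rule integral_cong_AE)
    show "AE x in lebesgue. f x \<bullet> g x = f' x \<bullet> g' x"
      using * unfolding l2_eq_def by (auto elim: eventually_elim2)
  qed (use * in \<open>auto simp: l2_eq_def dest: square_integrable_inner\<close>)
qed

definition norm_l2 :: "('a, 'b) l2 \<Rightarrow> real" where "norm_l2 f = sqrt (f \<bullet> f)"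

definition sgn_l2 :: "('a, 'b) l2 \<Rightarrow> ('a, 'b) l2" where "sgn_l2 f = inverse (norm f) *\<^sub>R f"

definition dist_l2 :: "('a, 'b) l2 \<Rightarrow> ('a, 'b) l2 \<Rightarrow> real" where "dist_l2 f g = norm (f - g)"

definition uniformity_l2 :: "(('a, 'b) l2 \<times> ('a, 'b) l2) filter" where
  "uniformity_l2 = (INF e\<in>{0<..}. principal {(f, g). dist f g < e})"

definition open_l2 :: "('a, 'b) l2 set \<Rightarrow> bool" where
  "open_l2 U \<longleftrightarrow> (\<forall>f\<in>U. \<forall>\<^sub>F (f', g) in uniformity. f' = f \<longrightarrow> g \<in> U)"

instance
proof
  fix a b c :: "('a, 'b) l2" and r s :: real and U :: "('a, 'b) l2 set"
  show "a + b + c = a + (b + c)"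
    by transfer (auto simp: l2_eq_def add.assoc intro!: square_integrable_add)
  show "a + b = b + a"
    by transfer (auto simp: l2_eq_def add.commute intro!: square_integrable_add)
  show "0 + a = a"
    by transfer (auto simp: l2_eq_def)
  show "- a + a = 0"
    by transfer (auto simp: l2_eq_def square_integrable_zero)
  show "a - b = a + - b"
    by transfer (auto simp: l2_eq_def intro!: square_integrable_diff)
  show "r *\<^sub>R (a + b) = r *\<^sub>R a + r *\<^sub>R b"
    by transfer (auto simp: l2_eq_def scaleR_add_right
        intro!: square_integrable_add square_integrable_scaleR)
  show "(r + s) *\<^sub>R a = r *\<^sub>R a + s *\<^sub>R a"
    by transfer (auto simp: l2_eq_def scaleR_add_left
        intro!: square_integrable_add square_integrable_scaleR)
  show "r *\<^sub>R s *\<^sub>R a = (r * s) *\<^sub>R a"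
    by transfer (auto simp: l2_eq_def intro!: square_integrable_scaleR)
  show "1 *\<^sub>R a = a"
    by transfer (auto simp: l2_eq_def)
  show "sgn a = inverse (norm a) *\<^sub>R a" by (simp add: sgn_l2_def)
  show "dist a b = norm (a - b)" by (simp add: dist_l2_def)
  show "norm a = sqrt (a \<bullet> a)" by (simp add: norm_l2_def)
  show "(uniformity :: (('a, 'b) l2 \<times> ('a, 'b) l2) filter) =
      (INF e\<in>{0<..}. principal {(f, g). dist f g < e})"
    by (simp add: uniformity_l2_def)
  show "open U \<longleftrightarrow> (\<forall>f\<in>U. \<forall>\<^sub>F (f', g) in uniformity. f' = f \<longrightarrow> g \<in> U)"
    by (simp add: open_l2_def)
  show "a \<bullet> b = b \<bullet> a"
    by transfer (simp add: inner_commute)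
  show "(a + b) \<bullet> c = a \<bullet> c + b \<bullet> c"
    by transfer (auto simp: l2_eq_def inner_add_left square_integrable_inner)
  show "(r *\<^sub>R a) \<bullet> b = r * (a \<bullet> b)"
    by transfer simp
  show "0 \<le> a \<bullet> a"
    by transfer simp
  show "a \<bullet> a = 0 \<longleftrightarrow> a = 0"
  proof transfer
    fix f :: "'a \<Rightarrow> 'b"
    assume "l2_eq f f"
    then have f: "square_integrable f" by (simp add: l2_eq_def)
    have "(\<integral>x. f x \<bullet> f x \<partial>lebesgue) = 0 \<longleftrightarrow> (AE x in lebesgue. f x \<bullet> f x = 0)"
      by (rule integral_nonneg_eq_0_iff_AE) (auto intro: square_integrable_inner f)
    then show "(\<integral>x. f x \<bullet> f x \<partial>lebesgue) = 0 \<longleftrightarrow> l2_eq f (\<lambda>_. 0)"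
      by (auto simp: l2_eq_def f square_integrable_zero)
  qed
qed

end

section \<open>Continuously differentiable maps\<close>

text \<open>Maps of class \<open>C\<^sup>k\<close> on \<open>S\<close> with values in the subspace \<open>X\<close>. Derivatives are taken within
  \<open>S\<close>, so that they are one-sided on the boundary of a closed cube. As the domain is
  finite-dimensional, the Frechet derivative of \<open>f\<close> is \<open>C\<^sup>k\<close> (in operator norm) iff all
  directional derivatives of \<open>f\<close> are.\<close>

primrec C_k_on :: "nat \<Rightarrow> 'a::euclidean_space set \<Rightarrow> 'b::real_normed_vector set \<Rightarrow> ('a \<Rightarrow> 'b) \<Rightarrow> bool"
where
  "C_k_on 0 S X f \<longleftrightarrow> f ` S \<subseteq> X \<and> continuous_on S f"
| "C_k_on (Suc k) S X f \<longleftrightarrow> f ` S \<subseteq> X \<and>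
     (\<exists>f'. (\<forall>x\<in>S. (f has_derivative f' x) (at x within S)) \<and>
           (\<forall>v. C_k_on k S X (\<lambda>x. f' x v)))"

definition partial_deriv ::
  "(real ^ 'n) set \<Rightarrow> 'n \<Rightarrow> (real ^ 'n \<Rightarrow> 'b::real_normed_vector) \<Rightarrow> real ^ 'n \<Rightarrow> 'b" where
  "partial_deriv S i f = (\<lambda>t. frechet_derivative f (at t within S) (axis i 1))"

definition multi_index_order :: "('n::finite \<Rightarrow> nat) \<Rightarrow> nat" where
  "multi_index_order \<alpha> = (\<Sum>i\<in>UNIV. \<alpha> i)"

text \<open>The index type carries no order, so \<open>\<partial>\<^sup>\<alpha>\<close> applies \<open>\<alpha> i\<close> derivatives in direction \<open>i\<close>
  in an arbitrary order, which is irrelevant for functions of class \<open>C\<^sup>k\<close>, \<open>k \<ge> \<bar>\<alpha>\<bar>\<close>.\<close>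

definition multi_deriv ::
  "(real ^ 'n) set \<Rightarrow> ('n \<Rightarrow> nat) \<Rightarrow> (real ^ 'n \<Rightarrow> 'b::real_normed_vector) \<Rightarrow> real ^ 'n \<Rightarrow> 'b" where
  "multi_deriv S \<alpha> f = foldr (partial_deriv S) (SOME is. \<forall>i. count_list is i = \<alpha> i) f"

section \<open>Sobolev spaces\<close>

definition test_function :: "'a::euclidean_space set \<Rightarrow> ('a \<Rightarrow> real) \<Rightarrow> bool" where
  "test_function \<Omega> \<phi> \<longleftrightarrow> (\<forall>k. C_k_on k UNIV UNIV \<phi>) \<and>
     compact (closure {x. \<phi> x \<noteq> 0}) \<and> closure {x. \<phi> x \<noteq> 0} \<subseteq> \<Omega>"

text \<open>An \<open>H\<^sup>1\<close> function \<open>u\<close>, extended by zero outside \<open>\<Omega>\<close>, is represented by the pair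
  \<open>(u, \<nabla>u)\<close> of its class and the class of its weak gradient, so that the norm of the product
  type is the \<open>H\<^sup>1\<close> norm \<open>sqrt (\<parallel>u\<parallel>\<^sup>2 + \<parallel>\<nabla>u\<parallel>\<^sup>2)\<close>. In particular \<open>H01 \<Omega>\<close> is the closure of
  the test functions on \<open>\<Omega>\<close> in the \<open>H\<^sup>1\<close> norm.\<close>

type_synonym 'a h1 = "('a, real) l2 \<times> ('a, 'a) l2"

definition value_fn :: "'a::euclidean_space h1 \<Rightarrow> 'a \<Rightarrow> real" where
  "value_fn u = rep_l2 (fst u)"

definition grad_fn :: "'a::euclidean_space h1 \<Rightarrow> 'a \<Rightarrow> 'a" where
  "grad_fn u = rep_l2 (snd u)"

definition H01 :: "'a::euclidean_space set \<Rightarrow> 'a h1 set" where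
  "H01 \<Omega> = closure {(abs_l2 \<phi>, abs_l2 g) | \<phi> g. test_function \<Omega> \<phi> \<and> (\<forall>x. GDERIV \<phi> x :> g x)}"

text \<open>Only the values of \<open>F\<close> on \<open>H01 \<Omega>\<close> matter.\<close>

definition H_minus_1 :: "'a::euclidean_space set \<Rightarrow> ('a h1 \<Rightarrow> real) set" where
  "H_minus_1 \<Omega> = {F. (\<forall>u\<in>H01 \<Omega>. \<forall>v\<in>H01 \<Omega>. F (u + v) = F u + F v) \<and>
     (\<forall>c. \<forall>v\<in>H01 \<Omega>. F (c *\<^sub>R v) = c * F v) \<and>
     (\<exists>B. \<forall>v\<in>H01 \<Omega>. \<bar>F v\<bar> \<le> B * norm v)}"

definition L_infinity :: "'a::euclidean_space set \<Rightarrow> ('a \<Rightarrow> real) set" where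
  "L_infinity \<Omega> = {m. m \<in> borel_measurable (lebesgue_on \<Omega>) \<and>
     (\<exists>B. AE x in lebesgue_on \<Omega>. \<bar>m x\<bar> \<le> B)}"

section \<open>Domains\<close>

definition convex_polyhedral_domain :: "'a::euclidean_space set \<Rightarrow> bool" where
  "convex_polyhedral_domain \<Omega> \<longleftrightarrow> open \<Omega> \<and> convex \<Omega> \<and> \<Omega> \<noteq> {} \<and> polytope (closure \<Omega>)"

definition C11_function :: "('a::euclidean_space \<Rightarrow> real) \<Rightarrow> bool" where
  "C11_function \<gamma> \<longleftrightarrow>
     (\<exists>g L. (\<forall>x. GDERIV \<gamma> x :> g x) \<and> L-lipschitz_on UNIV g)"

text \<open>Near each boundary point, \<open>\<Omega>\<close> lies on one side of the graph of a \<open>C\<^sup>1\<^sup>,\<^sup>1\<close> function over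
  the hyperplane orthogonal to a unit vector \<open>e\<close>. The projection of \<open>x\<close> onto this
  hyperplane is \<open>x - (x \<bullet> e) *\<^sub>R e\<close>, so only the values of \<open>\<gamma>\<close> on the hyperplane matter.\<close>

definition bounded_C11_domain :: "'a::euclidean_space set \<Rightarrow> bool" where
  "bounded_C11_domain \<Omega> \<longleftrightarrow> open \<Omega> \<and> connected \<Omega> \<and> \<Omega> \<noteq> {} \<and> bounded \<Omega> \<and>
     (\<forall>p\<in>frontier \<Omega>. \<exists>r>0. \<exists>e \<gamma>. norm e = 1 \<and> C11_function \<gamma> \<and>
        \<Omega> \<inter> ball p r = {x \<in> ball p r. \<gamma> (x - (x \<bullet> e) *\<^sub>R e) < x \<bullet> e})"

section \<open>The parametric problem\<close>

definition affine_coeff :: "('a \<Rightarrow> real) \<Rightarrow> ('n::finite \<Rightarrow> 'a \<Rightarrow> real) \<Rightarrow> real ^ 'n \<Rightarrow> 'a \<Rightarrow> real" where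
  "affine_coeff c0 c t x = c0 x + (\<Sum>i\<in>UNIV. t $ i * c i x)"

definition weak_solution ::
  "'a::euclidean_space set \<Rightarrow> ('a \<Rightarrow> real) \<Rightarrow> ('a h1 \<Rightarrow> real) \<Rightarrow> 'a h1 \<Rightarrow> bool" where
  "weak_solution \<Omega> m F u \<longleftrightarrow> u \<in> H01 \<Omega> \<and>
     (\<forall>v\<in>H01 \<Omega>. (\<integral>x. grad_fn u x \<bullet> grad_fn v x \<partial>lebesgue_on \<Omega>) +
                 (\<integral>x. m x * value_fn u x * value_fn v x \<partial>lebesgue_on \<Omega>) = F v)"

definition unit_cube :: "(real ^ 'n) set" where
  "unit_cube = cbox 0 1"

end

theory Submission
  imports Defs
begin

text \<open>The solution map inherits its smoothness from the affine dependence on \<open>t\<close>. In the Hilbert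
  space of pairs \<open>(u, \<nabla>u)\<close> the weak form is \<open>A(t) u \<bullet> v = g(t) \<bullet> v\<close> for \<open>v\<close> in \<open>H01 \<Omega>\<close>, with
  \<open>A(t) = A\<^sub>0 + \<Sum>i. t\<^sub>i M\<^sub>i\<close> bounded and \<open>g\<close> affine in \<open>t\<close>; the \<open>M\<^sub>i\<close> multiply by the coefficients \<open>\<mu>\<^sub>i\<close>, and
  \<open>g\<close> collects the Riesz representers of the functionals \<open>f\<^sub>i\<close>. Since the coefficient is at least
  \<open>\<mu>_min > 0\<close>, the form is coercive on \<open>H01 \<Omega>\<close> uniformly in \<open>t\<close> (\<open>operator_coercive\<close>).

  Formal differentiation of the equation in a direction \<open>h\<close> gives
  \<open>A(t) (u' h) = g' h - \<Sum>i. h\<^sub>i M\<^sub>i u(t)\<close>, a problem of the same kind, which is solvable by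
  \<open>symmetric_Lax_Milgram\<close> because \<open>L\<^sup>2\<close>, and with it its closed subspace \<open>H01 \<Omega>\<close>, is complete. The remainder of the
  linear approximation solves a further problem of this kind with a small right-hand side, so the
  a priori bound \<open>stability\<close> shows that \<open>u'\<close> is the derivative (\<open>solution_has_derivative\<close>). Its right-hand
  side contains only \<open>g'\<close> and \<open>u\<close>, which drives an induction on the order of differentiability
  (\<open>C_k_on_solution\<close>).

  The Lipschitz bounds then follow from smoothness alone: every multi-index derivative of an
  infinitely smooth map is \<open>C\<^sup>1\<close> on the compact convex cube, hence Lipschitz there. The constants
  depend only on the data because the data determine the solution map on the cube.\<close>

section \<open>Calculus of \<open>C\<^sup>k\<close> maps\<close>

lemma C_k_on_cong:
  assumes "C_k_on k S X f" and "\<And>x. x \<in> S \<Longrightarrow> f x = g x"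
  shows "C_k_on k S X g"
proof (cases k)
  case 0
  with assms show ?thesis
    by (metis C_k_on.simps(1) continuous_on_cong image_cong)
next
  case (Suc j)
  with assms obtain f' where "\<forall>x\<in>S. (f has_derivative f' x) (at x within S)"
    "\<forall>v. C_k_on j S X (\<lambda>x. f' x v)" and "f ` S \<subseteq> X" by auto
  moreover have "g ` S = f ` S" using assms(2) by (simp cong: image_cong)
  moreover have "(g has_derivative f' x) (at x within S)"
    if "x \<in> S" "(f has_derivative f' x) (at x within S)" for x
    using has_derivative_transform[OF that(1) _ that(2), of g] assms(2) by simp
  ultimately show ?thesis unfolding Suc C_k_on.simps by metis
qed

lemma C_k_on_SucD: "C_k_on (Suc k) S X f \<Longrightarrow> C_k_on k S X f"
proof (induction k arbitrary: f)
  case 0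
  then show ?case
    by (auto simp: continuous_on_eq_continuous_within intro: has_derivative_continuous)
next
  case (Suc k)
  obtain f' where f': "f ` S \<subseteq> X" "\<forall>x\<in>S. (f has_derivative f' x) (at x within S)"
    "\<forall>v. C_k_on (Suc k) S X (\<lambda>x. f' x v)"
    using Suc.prems unfolding C_k_on.simps(2)[of "Suc k"] by blast
  then have "\<forall>v. C_k_on k S X (\<lambda>x. f' x v)" using Suc.IH by blast
  with f'(1,2) show ?case by (subst C_k_on.simps) blast
qed

lemma C_k_on_zero: "0 \<in> X \<Longrightarrow> C_k_on k S X (\<lambda>_. 0)"
proof (induction k)
  case (Suc k)
  then have "\<forall>v. C_k_on k S X (\<lambda>_. 0)" and "(\<lambda>_. 0) ` S \<subseteq> X" by auto
  then show ?case
    by (subst C_k_on.simps, intro conjI exI[of _ "\<lambda>_ _. 0"])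
      (simp_all del: C_k_on.simps)
qed (simp add: image_subset_iff)

lemma C_k_on_const: "c \<in> X \<Longrightarrow> 0 \<in> X \<Longrightarrow> C_k_on k S X (\<lambda>_. c)"
proof (cases k)
  case (Suc j)
  assume "c \<in> X" "0 \<in> X"
  then show ?thesis unfolding Suc C_k_on.simps
    by (intro conjI exI[of _ "\<lambda>_ _. 0"]) (auto intro: C_k_on_zero)
qed (simp add: image_subset_iff)

lemma C_k_on_bounded_linear:
  assumes "bounded_linear T" "C_k_on k S X f" "T ` X \<subseteq> Y"
  shows "C_k_on k S Y (\<lambda>x. T (f x))"
  using assms(2)
proof (induction k arbitrary: f)
  case 0
  then show ?case using assms(1,3)
    using bounded_linear.continuous_on[OF assms(1), of S f] by auto
next
  case (Suc k)
  obtain f' where f': "f ` S \<subseteq> X" "\<forall>x\<in>S. (f has_derivative f' x) (at x within S)"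
    "\<forall>v. C_k_on k S X (\<lambda>x. f' x v)" using Suc.prems by auto
  have "\<forall>x\<in>S. ((\<lambda>x. T (f x)) has_derivative (\<lambda>v. T (f' x v))) (at x within S)"
    using bounded_linear.has_derivative[OF assms(1)] f'(2) by blast
  moreover have "(\<lambda>x. T (f x)) ` S \<subseteq> Y" using f'(1) assms(3) by auto
  ultimately show ?case
    using Suc.IH f'(3) unfolding C_k_on.simps
    by (intro conjI exI[of _ "\<lambda>x v. T (f' x v)"]) auto
qed

lemma C_k_on_add:
  assumes "C_k_on k S X f" "C_k_on k S X g" "\<And>x y. x \<in> X \<Longrightarrow> y \<in> X \<Longrightarrow> x + y \<in> X"
  shows "C_k_on k S X (\<lambda>x. f x + g x)"
  using assms(1,2)
proof (induction k arbitrary: f g)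
  case 0
  then show ?case using assms(3) by (auto intro!: continuous_on_add simp: image_subset_iff)
next
  case (Suc k)
  obtain f' g' where f': "f ` S \<subseteq> X" "\<forall>x\<in>S. (f has_derivative f' x) (at x within S)"
    "\<forall>v. C_k_on k S X (\<lambda>x. f' x v)" and g': "g ` S \<subseteq> X"
    "\<forall>x\<in>S. (g has_derivative g' x) (at x within S)" "\<forall>v. C_k_on k S X (\<lambda>x. g' x v)"
    using Suc.prems by auto
  have "\<forall>x\<in>S. ((\<lambda>x. f x + g x) has_derivative (\<lambda>v. f' x v + g' x v)) (at x within S)"
    using f'(2) g'(2) by (auto intro: has_derivative_add)
  moreover have "(\<lambda>x. f x + g x) ` S \<subseteq> X" using f'(1) g'(1) assms(3) by auto
  ultimately show ?case
    using Suc.IH f'(3) g'(3) unfolding C_k_on.simps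
    by (intro conjI exI[of _ "\<lambda>x v. f' x v + g' x v"]) auto
qed

text \<open>Globally linear maps supply the smooth data: a right-hand side affine in the parameter is a
  constant plus such a map.\<close>

lemma C_k_on_bounded_linear_map:
  assumes "bounded_linear T" shows "C_k_on k S UNIV T"
proof (cases k)
  case 0
  then show ?thesis using bounded_linear.continuous_on[OF assms continuous_on_id] by simp
next
  case (Suc j)
  show ?thesis unfolding Suc C_k_on.simps
    by (intro conjI exI[of _ "\<lambda>_. T"])
      (auto intro: C_k_on_const bounded_linear_imp_has_derivative assms)
qed

text \<open>One-sided derivatives on the cube are unique, also on its boundary, because the cube has
  interior points in every coordinate direction. This is what ties the derivative selected by
  \<open>partial_deriv\<close> to the one provided by \<open>C_k_on\<close>.\<close>

lemma derivative_unique_on_unit_cube: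
  fixes f :: "real ^ 'n::finite \<Rightarrow> 'b::real_normed_vector"
  assumes "t \<in> unit_cube"
    "(f has_derivative f') (at t within unit_cube)" "(f has_derivative f'') (at t within unit_cube)"
  shows "f' = f''"
proof (rule frechet_derivative_unique_within_closed_interval)
  show "(0 :: real ^ 'n) \<bullet> i < 1 \<bullet> i" if "i \<in> Basis" for i
    using that by (auto simp: Basis_vec_def inner_axis)
qed (use assms in \<open>auto simp: unit_cube_def\<close>)

lemma partial_deriv_on_unit_cube:
  fixes f :: "real ^ 'n::finite \<Rightarrow> 'b::real_normed_vector"
  assumes "t \<in> unit_cube" "(f has_derivative f') (at t within unit_cube)"
  shows "partial_deriv unit_cube i f t = f' (axis i 1)"
proof -
  have "(f has_derivative frechet_derivative f (at t within unit_cube)) (at t within unit_cube)"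
    using assms(2) frechet_derivative_works differentiableI by blast
  then show ?thesis
    using derivative_unique_on_unit_cube[OF assms(1) _ assms(2)] by (simp add: partial_deriv_def)
qed

lemma C_k_on_partial_deriv:
  fixes f :: "real ^ 'n::finite \<Rightarrow> 'b::real_normed_vector"
  assumes "C_k_on (Suc k) unit_cube X f"
  shows "C_k_on k unit_cube X (partial_deriv unit_cube i f)"
proof -
  obtain f' where f': "\<forall>x\<in>unit_cube. (f has_derivative f' x) (at x within unit_cube)"
    "\<forall>v. C_k_on k unit_cube X (\<lambda>x. f' x v)" using assms by auto
  have "partial_deriv unit_cube i f x = f' x (axis i 1)" if "x \<in> unit_cube" for x
    using partial_deriv_on_unit_cube f'(1) that by blast
  then show ?thesis using C_k_on_cong[OF f'(2)[rule_format, of "axis i 1"]] by metis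
qed

text \<open>Every partial derivative costs one order of smoothness, which an infinitely smooth map can
  always afford. The claim holds for every list of directions in place of the one selected in
  \<open>multi_deriv\<close>, by induction on the list.\<close>

lemma C_infinity_multi_deriv:
  fixes f :: "real ^ 'n::finite \<Rightarrow> 'b::real_normed_vector"
  assumes "\<And>k. C_k_on k unit_cube X f"
  shows "C_k_on k unit_cube X (multi_deriv unit_cube \<alpha> f)"
proof -
  have "C_k_on k unit_cube X (foldr (partial_deriv unit_cube) is f)" for k "is"
    by (induction "is" arbitrary: k) (auto intro: assms C_k_on_partial_deriv simp del: C_k_on.simps)
  then show ?thesis by (simp add: multi_deriv_def)
qed

text \<open>Derivatives within \<open>S\<close> see only the values on \<open>S\<close>, although \<open>frechet_derivative\<close> is a choice:
  both functions have the same set of derivatives, so the same one is chosen. This allows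
  replacing a solution map by any other one that agrees with it on the cube.\<close>

lemma multi_deriv_cong:
  fixes f g :: "real ^ 'n::finite \<Rightarrow> 'b::real_normed_vector"
  assumes "\<And>t. t \<in> S \<Longrightarrow> f t = g t" "t \<in> S"
  shows "multi_deriv S \<alpha> f t = multi_deriv S \<alpha> g t"
proof -
  have *: "partial_deriv S i p t = partial_deriv S i q t"
    if pq: "\<And>t. t \<in> S \<Longrightarrow> p t = q t" and t: "t \<in> S" for p q :: "real ^ 'n \<Rightarrow> 'b" and i t
  proof -
    have "(p has_derivative D) (at t within S) = (q has_derivative D) (at t within S)" for D
      using has_derivative_transform[OF t, of p q] has_derivative_transform[OF t, of q p] pq
      by metis
    then show ?thesis unfolding partial_deriv_def frechet_derivative_def by simp
  qed
  have "\<forall>t\<in>S. foldr (partial_deriv S) is f t = foldr (partial_deriv S) is g t" for "is"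
    by (induction "is") (auto intro!: * assms)
  with assms(2) show ?thesis by (simp add: multi_deriv_def)
qed

text \<open>The cube is compact and convex. The directional derivatives along the coordinate axes are
  continuous, hence bounded, and they bound the operator norm of the derivative; the mean value
  inequality then gives a Lipschitz constant.\<close>

lemma C_1_on_unit_cube_imp_Lipschitz:
  fixes f :: "real ^ 'n::finite \<Rightarrow> 'b::real_normed_vector"
  assumes "C_k_on 1 unit_cube X f"
  shows "\<exists>C. \<forall>s\<in>unit_cube. \<forall>t\<in>unit_cube. norm (f s - f t) \<le> C * norm (s - t)"
proof -
  obtain f' where f': "\<And>x. x \<in> unit_cube \<Longrightarrow> (f has_derivative f' x) (at x within unit_cube)"
    "\<And>v. continuous_on unit_cube (\<lambda>x. f' x v)" using assms unfolding One_nat_def C_k_on.simps by blast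
  have "\<exists>B. \<forall>x\<in>unit_cube. norm (f' x v) \<le> B" for v
    using compact_imp_bounded[OF compact_continuous_image[OF f'(2)]]
    by (fastforce simp: unit_cube_def bounded_iff)
  then obtain B where B: "\<And>v x. x \<in> unit_cube \<Longrightarrow> norm (f' x v) \<le> B v" by metis
  have "onorm (f' x) \<le> (\<Sum>i\<in>UNIV. B (axis i 1))" if x: "x \<in> unit_cube" for x
  proof (rule onorm_le)
    fix v
    have lin: "linear (f' x)" using f'(1)[OF x] has_derivative_linear by blast
    have "f' x v = f' x (\<Sum>i\<in>UNIV. v $ i *\<^sub>R axis i 1)"
      using basis_expansion[of v] by (simp add: scalar_mult_eq_scaleR)
    also have "\<dots> = (\<Sum>i\<in>UNIV. v $ i *\<^sub>R f' x (axis i 1))"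
      by (simp add: linear_sum[OF lin] linear_scale[OF lin])
    also have "norm \<dots> \<le> (\<Sum>i\<in>UNIV. norm v * B (axis i 1))"
      by (rule sum_norm_le) (auto intro!: mult_mono B x component_le_norm_cart)
    finally show "norm (f' x v) \<le> (\<Sum>i\<in>UNIV. B (axis i 1)) * norm v"
      by (simp add: sum_distrib_left[symmetric] mult.commute)
  qed
  with differentiable_bound[OF _ f'(1)] show ?thesis
    by (metis convex_box(1) unit_cube_def)
qed

section \<open>Symmetric coercive problems\<close>

lemma quadratic_nonneg_imp_linear_part_zero:
  fixes p q :: real
  assumes "\<And>s. 0 \<le> 2 * s * p + s\<^sup>2 * q"
  shows "p = 0"
proof (rule ccontr)
  assume "p \<noteq> 0"
  \<comment> \<open>At \<open>s = - r p\<close> with small \<open>r > 0\<close> the linear part dominates and is negative.\<close>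
  define r where "r = 1 / (\<bar>q\<bar> + 1)"
  have r: "r > 0" "r * q < 1"
    by (auto simp: r_def field_simps)
  have "0 \<le> 2 * (- r * p) * p + (- r * p)\<^sup>2 * q" by (rule assms)
  also have "\<dots> = r * p\<^sup>2 * (r * q - 2)" by (simp add: power2_eq_square algebra_simps)
  also have "\<dots> < 0" using r \<open>p \<noteq> 0\<close> by (intro mult_pos_neg) auto
  finally show False by simp
qed

text \<open>The solution is the minimiser of the energy \<open>J v = A v \<bullet> v - 2 L v\<close>. Coercivity bounds \<open>J\<close> from
  below and, by the parallelogram identity, turns every minimising sequence into a Cauchy
  sequence. Its limit satisfies the equation because the first variation of \<open>J\<close> vanishes there.
  Taking the identity for \<open>A\<close> gives the Riesz representation theorem.\<close>

lemma symmetric_Lax_Milgram: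
  fixes A :: "'h::real_inner \<Rightarrow> 'h"
  assumes V: "subspace V" "complete V"
    and A: "bounded_linear A" and sym: "\<And>v w. v \<in> V \<Longrightarrow> w \<in> V \<Longrightarrow> A v \<bullet> w = A w \<bullet> v"
    and c: "0 < c" and coercive: "\<And>v. v \<in> V \<Longrightarrow> c * (norm v)\<^sup>2 \<le> A v \<bullet> v"
    and L_add: "\<And>v w. v \<in> V \<Longrightarrow> w \<in> V \<Longrightarrow> L (v + w) = L v + L w"
    and L_scale: "\<And>r v. v \<in> V \<Longrightarrow> L (r *\<^sub>R v) = r * L v"
    and L_bound: "\<And>v. v \<in> V \<Longrightarrow> \<bar>L v\<bar> \<le> B * norm v"
  shows "\<exists>u\<in>V. \<forall>v\<in>V. A u \<bullet> v = L v"
proof -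
  interpret A: bounded_linear A by (rule A)
  define J where "J v = A v \<bullet> v - 2 * L v" for v
  have J_add: "J (v + s *\<^sub>R w) = J v + 2 * s * (A v \<bullet> w - L w) + s\<^sup>2 * (A w \<bullet> w)"
    if "v \<in> V" "w \<in> V" for v w s
    using that sym[of w v] V(1)
    by (simp add: J_def A.add A.scaleR inner_add L_add L_scale subspace_scale power2_eq_square
        algebra_simps)
  have lower: "- (B\<^sup>2 / c) \<le> J v" if "v \<in> V" for v
  proof -
    have "0 \<le> (c * norm v - B)\<^sup>2" by simp
    then have "c * (2 * B * norm v) \<le> c * (c * (norm v)\<^sup>2 + B\<^sup>2 / c)"
      using c by (simp add: power2_eq_square algebra_simps)
    then have "2 * B * norm v \<le> c * (norm v)\<^sup>2 + B\<^sup>2 / c"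
      using c by (simp only: mult_le_cancel_left_pos)
    moreover have "L v \<le> B * norm v" using L_bound[OF that] by linarith
    ultimately show ?thesis using coercive[OF that] unfolding J_def by linarith
  qed
  define m where "m = Inf (J ` V)"
  have bdd: "bdd_below (J ` V)" using lower by (intro bdd_belowI[of _ "- (B\<^sup>2 / c)"]) auto
  have m: "m \<le> J v" if "v \<in> V" for v
    unfolding m_def using bdd that by (intro cInf_lower imageI)
  have "\<exists>v\<in>V. J v < m + 1 / real (Suc n)" for n
  proof -
    have "J ` V \<noteq> {}" using subspace_0[OF V(1)] by auto
    moreover have "Inf (J ` V) < m + 1 / real (Suc n)" by (simp add: m_def)
    ultimately show ?thesis using cInf_lessD[of "J ` V"] by fastforce
  qed
  then obtain x where x: "\<And>n. x n \<in> V" "\<And>n. J (x n) < m + 1 / real (Suc n)" by metis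
  \<comment> \<open>The energy at the midpoint of \<open>x i\<close> and \<open>x j\<close> is at least \<open>m\<close>, while at the endpoints it is
    almost \<open>m\<close>; by coercivity the endpoints are close.\<close>
  have close: "c * (norm (x i - x j))\<^sup>2 \<le> 2 * (1 / real (Suc i) + 1 / real (Suc j))" for i j
  proof -
    define d where "d = x j - x i"
    have d: "d \<in> V" using x V(1) by (simp add: d_def subspace_diff)
    have "x i + (1/2) *\<^sub>R d \<in> V" using x(1) d V(1) by (simp add: subspace_add subspace_scale)
    from m[OF this] have "m \<le> J (x i + (1/2) *\<^sub>R d)" .
    moreover have "J (x j) = J (x i + 1 *\<^sub>R d)" by (simp add: d_def)
    moreover have "c * (norm d)\<^sup>2 \<le> A d \<bullet> d" by (rule coercive[OF d])
    moreover have "norm (x i - x j) = norm d" by (simp add: d_def norm_minus_commute)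
    ultimately show ?thesis
      using x(2)[of i] x(2)[of j] J_add[OF x(1) d, of i "1/2"] J_add[OF x(1) d, of i 1]
      by (simp add: power2_eq_square algebra_simps)
  qed
  have "Cauchy x"
  proof (rule metric_CauchyI)
    fix e :: real assume "e > 0"
    then have "0 < c * e\<^sup>2 / 4" using c by simp
    then obtain N where N: "1 / real (Suc N) < c * e\<^sup>2 / 4" using nat_approx_posE by blast
    have quarter: "a < d" if "a \<le> 2 * (p + q)" "p < d / 4" "q < d / 4" for a d p q :: real
      using that by (simp add: field_simps)
    have "dist (x i) (x j) < e" if "i \<ge> N" "j \<ge> N" for i j
    proof -
      have *: "1 / real (Suc k) < c * e\<^sup>2 / 4" if "k \<ge> N" for k
        using frac_le[of 1 1 "real (Suc N)" "real (Suc k)"] that by (intro le_less_trans[OF _ N]) simp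
      have "c * (norm (x i - x j))\<^sup>2 < c * e\<^sup>2"
        using close[of i j] quarter[OF _ *[OF that(1)] *[OF that(2)]] by simp
      then have "(norm (x i - x j))\<^sup>2 < e\<^sup>2" using c by simp
      then show ?thesis using \<open>e > 0\<close> by (simp add: dist_norm power2_less_imp_less)
    qed
    then show "\<exists>M. \<forall>i\<ge>M. \<forall>j\<ge>M. dist (x i) (x j) < e" by blast
  qed
  then obtain u where u: "u \<in> V" "x \<longlonglongrightarrow> u" using V(2) x(1) unfolding complete_def by blast
  have "A u \<bullet> v = L v" if v: "v \<in> V" for v
  proof -
    \<comment> \<open>A variation of \<open>x n\<close> in the direction \<open>v\<close> lowers the energy by at most \<open>1 / (n + 1)\<close>, so in
      the limit a variation of \<open>u\<close> does not lower it at all.\<close>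
    have "0 \<le> 2 * s * (A u \<bullet> v - L v) + s\<^sup>2 * (A v \<bullet> v)" for s
    proof (rule LIMSEQ_le)
      show "(\<lambda>n. - (1 / real (Suc n))) \<longlonglongrightarrow> 0"
        using tendsto_minus[OF LIMSEQ_inverse_real_of_nat] by (simp add: inverse_eq_divide)
      show "(\<lambda>n. 2 * s * (A (x n) \<bullet> v - L v) + s\<^sup>2 * (A v \<bullet> v))
          \<longlonglongrightarrow> 2 * s * (A u \<bullet> v - L v) + s\<^sup>2 * (A v \<bullet> v)"
        by (intro tendsto_intros A.tendsto u)
      have "- (1 / real (Suc n)) \<le> 2 * s * (A (x n) \<bullet> v - L v) + s\<^sup>2 * (A v \<bullet> v)" for n
        using m[of "x n + s *\<^sub>R v"] x[of n] J_add[OF x(1) v, of n s] v V(1)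
        by (simp add: subspace_add subspace_scale)
      then show "\<exists>N. \<forall>n\<ge>N. - (1 / real (Suc n))
          \<le> 2 * s * (A (x n) \<bullet> v - L v) + s\<^sup>2 * (A v \<bullet> v)" by blast
    qed
    then show ?thesis using quadratic_nonneg_imp_linear_part_zero by force
  qed
  with u show ?thesis by blast
qed

section \<open>Parametric coercive problems\<close>

definition affine_operator :: "('h \<Rightarrow> 'h::real_vector) \<Rightarrow> ('n::finite \<Rightarrow> 'h \<Rightarrow> 'h) \<Rightarrow> real ^ 'n \<Rightarrow> 'h \<Rightarrow> 'h" where
  "affine_operator A\<^sub>0 M t u = A\<^sub>0 u + (\<Sum>i\<in>UNIV. t $ i *\<^sub>R M i u)"

text \<open>An abstract model of the parametric problem: on a complete subspace \<open>V\<close>, find \<open>u\<close> with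
  \<open>A(t) u \<bullet> v = g(t) \<bullet> v\<close> for all \<open>v\<close> in \<open>V\<close>, where \<open>A(t) = A\<^sub>0 + \<Sum>i. t\<^sub>i M\<^sub>i\<close> is symmetric and coercive
  on \<open>V\<close> uniformly in \<open>t\<close>. The operators act on the whole space, so that solutions can be inserted
  into right-hand sides.\<close>

locale coercive_affine_family =
  fixes V :: "'h::real_inner set" and A\<^sub>0 :: "'h \<Rightarrow> 'h" and M :: "'n::finite \<Rightarrow> 'h \<Rightarrow> 'h"
    and S :: "(real ^ 'n) set" and c :: real
  assumes subspace_V: "subspace V" and complete_V: "complete V"
    and bounded_linear_A0: "bounded_linear A\<^sub>0" and bounded_linear_M: "\<And>i. bounded_linear (M i)"
    and symmetric: "\<And>t v w. t \<in> S \<Longrightarrow> v \<in> V \<Longrightarrow> w \<in> V \<Longrightarrow>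
      affine_operator A\<^sub>0 M t v \<bullet> w = affine_operator A\<^sub>0 M t w \<bullet> v"
    and c_pos: "0 < c"
    and coercive: "\<And>t v. t \<in> S \<Longrightarrow> v \<in> V \<Longrightarrow> c * (norm v)\<^sup>2 \<le> affine_operator A\<^sub>0 M t v \<bullet> v"
begin

abbreviation "A \<equiv> affine_operator A\<^sub>0 M"

text \<open>The derivative of the operator family in the direction \<open>h\<close>.\<close>

definition M_dir :: "real ^ 'n \<Rightarrow> 'h \<Rightarrow> 'h" where
  "M_dir h u = (\<Sum>i\<in>UNIV. h $ i *\<^sub>R M i u)"

definition solves :: "real ^ 'n \<Rightarrow> 'h \<Rightarrow> 'h \<Rightarrow> bool" where
  "solves t g u \<longleftrightarrow> u \<in> V \<and> (\<forall>v\<in>V. A t u \<bullet> v = g \<bullet> v)"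

lemma bounded_linear_M_dir: "bounded_linear (M_dir h)"
  unfolding M_dir_def
  by (intro bounded_linear_sum bounded_linear_compose[OF bounded_linear_scaleR_right] bounded_linear_M)

lemma bounded_linear_A: "bounded_linear (A t)"
  using bounded_linear_add[OF bounded_linear_A0 bounded_linear_M_dir[of t]]
  by (simp add: affine_operator_def[abs_def] M_dir_def)

lemma A_diff: "A s u - A t u = M_dir (s - t) u"
  by (simp add: affine_operator_def M_dir_def scaleR_left_diff_distrib sum_subtractf)

lemma M_dir_linear: "M_dir (a + b) u = M_dir a u + M_dir b u" "M_dir (r *\<^sub>R a) u = r *\<^sub>R M_dir a u"
  by (simp_all add: M_dir_def scaleR_left_distrib sum.distrib scaleR_sum_right)

lemma M_dir_bound: "\<exists>K\<ge>0. \<forall>h u. norm (M_dir h u) \<le> K * norm h * norm u"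
proof (intro exI conjI allI)
  show "0 \<le> (\<Sum>i\<in>UNIV. onorm (M i))"
    by (intro sum_nonneg onorm_pos_le bounded_linear_M)
  fix h u
  have "norm (M_dir h u) \<le> (\<Sum>i\<in>UNIV. norm h * (onorm (M i) * norm u))"
    unfolding M_dir_def
  proof (rule sum_norm_le)
    fix i
    have "norm (h $ i *\<^sub>R M i u) \<le> \<bar>h $ i\<bar> * (onorm (M i) * norm u)"
      using onorm[OF bounded_linear_M, of i u] by (simp add: mult_left_mono)
    also have "\<dots> \<le> norm h * (onorm (M i) * norm u)"
      by (intro mult_right_mono component_le_norm_cart mult_nonneg_nonneg onorm_pos_le bounded_linear_M) auto
    finally show "norm (h $ i *\<^sub>R M i u) \<le> norm h * (onorm (M i) * norm u)" .
  qed
  then show "norm (M_dir h u) \<le> (\<Sum>i\<in>UNIV. onorm (M i)) * norm h * norm u"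
    by (simp add: sum_distrib_left[symmetric] sum_distrib_right[symmetric] mult_ac)
qed

lemma solution_exists: "t \<in> S \<Longrightarrow> \<exists>u. solves t g u"
  using symmetric_Lax_Milgram[OF subspace_V complete_V bounded_linear_A symmetric c_pos coercive,
      of t "\<lambda>v. g \<bullet> v" "norm g"]
  by (auto simp: solves_def inner_add_right Cauchy_Schwarz_ineq2)

text \<open>Test with the solution itself.\<close>

lemma stability:
  assumes "t \<in> S" "solves t g u"
  shows "c * norm u \<le> norm g"
proof (cases "u = 0")
  case False
  have "c * (norm u)\<^sup>2 \<le> g \<bullet> u"
    using coercive[OF assms(1), of u] assms(2) unfolding solves_def by auto
  also have "\<dots> \<le> norm g * norm u" by (rule norm_cauchy_schwarz)
  finally show ?thesis using False by (simp add: power2_eq_square)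
qed simp

lemma solves_add: "solves t g u \<Longrightarrow> solves t g' u' \<Longrightarrow> solves t (g + g') (u + u')"
  using subspace_V by (simp add: solves_def subspace_add linear_simps[OF bounded_linear_A] inner_add_left)

lemma solves_scaleR: "solves t g u \<Longrightarrow> solves t (r *\<^sub>R g) (r *\<^sub>R u)"
  using subspace_V by (simp add: solves_def subspace_scale linear_simps[OF bounded_linear_A])

lemma solves_diff: "solves t g u \<Longrightarrow> solves t g' u' \<Longrightarrow> solves t (g - g') (u - u')"
  using solves_add[of t g u "- g'" "- u'"] solves_scaleR[of t g' u' "-1"] by simp

text \<open>A solution for the parameter \<open>t\<close> solves the problem for the parameter \<open>s\<close> with a corrected
  right-hand side. Hence increments and Taylor remainders of the solution map are solutions
  themselves, and \<open>solution_bound\<close> estimates them.\<close>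

lemma solves_shift: "solves t g u \<Longrightarrow> solves s (g + M_dir (s - t) u) u"
  using A_diff[of s u t] by (auto simp: solves_def inner_add_left algebra_simps)

lemma solves_unique: "t \<in> S \<Longrightarrow> solves t g u \<Longrightarrow> solves t g u' \<Longrightarrow> u = u'"
  using stability[OF _ solves_diff, of t g u g u'] c_pos by (simp add: mult_le_0_iff)

lemma solution_bound: "t \<in> S \<Longrightarrow> solves t g u \<Longrightarrow> norm u \<le> norm g / c"
  using stability[of t g u] c_pos by (simp add: field_simps)

lemma solution_continuous:
  assumes u: "\<And>t. t \<in> S \<Longrightarrow> solves t (g t) (u t)" and g: "continuous_on S g"
  shows "continuous_on S u"
  unfolding continuous_on
proof
  fix t assume t: "t \<in> S"
  obtain K where K: "\<And>h w. norm (M_dir h w) \<le> K * norm h * norm w" using M_dir_bound by blast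
  have "((\<lambda>s. u s - u t) \<longlongrightarrow> 0) (at t within S)"
  proof (rule Lim_null_comparison)
    show "\<forall>\<^sub>F s in at t within S. norm (u s - u t) \<le> (norm (g s - g t) + K * norm (s - t) * norm (u t)) / c"
      unfolding eventually_at_filter
    proof (intro always_eventually allI impI)
      fix s assume s: "s \<in> S"
      have "solves s (g s - (g t + M_dir (s - t) (u t))) (u s - u t)"
        by (intro solves_diff solves_shift u s t)
      then have "norm (u s - u t) \<le> norm (g s - (g t + M_dir (s - t) (u t))) / c"
        by (rule solution_bound[OF s])
      also have "\<dots> \<le> (norm (g s - g t) + K * norm (s - t) * norm (u t)) / c"
        using norm_triangle_ineq4[of "g s - g t" "M_dir (s - t) (u t)"] K[of "s - t" "u t"] c_pos
        by (simp add: divide_le_cancel algebra_simps)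
      finally show "norm (u s - u t) \<le> (norm (g s - g t) + K * norm (s - t) * norm (u t)) / c" .
    qed
    have "(g \<longlongrightarrow> g t) (at t within S)" using g t by (auto simp: continuous_on)
    then have "((\<lambda>s. (norm (g s - g t) + K * norm (s - t) * norm (u t)) / c)
      \<longlongrightarrow> (norm (g t - g t) + K * norm (t - t) * norm (u t)) / c) (at t within S)"
      using c_pos by (intro tendsto_intros) auto
    then show "((\<lambda>s. (norm (g s - g t) + K * norm (s - t) * norm (u t)) / c) \<longlongrightarrow> 0) (at t within S)"
      by simp
  qed
  then show "(u \<longlongrightarrow> u t) (at t within S)" using Lim_null by blast
qed

text \<open>Differentiating \<open>A(t) u(t) = g(t)\<close> in the direction \<open>h\<close> suggests \<open>A(t) (D h) = g' h - M_dir h (u t)\<close>.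
  With \<open>h = s - t\<close>, the remainder \<open>u(s) - u(t) - D h\<close> solves the problem for the parameter \<open>s\<close> with the
  right-hand side \<open>g(s) - g(t) - g' h - M_dir h (D h)\<close>, which is \<open>o(\<parallel>h\<parallel>)\<close>.\<close>

lemma solution_has_derivative:
  assumes t: "t \<in> S" and u: "\<And>s. s \<in> S \<Longrightarrow> solves s (g s) (u s)"
    and g: "(g has_derivative g') (at t within S)"
    and D: "\<And>h. solves t (g' h - M_dir h (u t)) (D h)"
  shows "(u has_derivative D) (at t within S)"
proof -
  obtain K where K: "K \<ge> 0" "\<And>h w. norm (M_dir h w) \<le> K * norm h * norm w" using M_dir_bound by blast
  have lin_g: "bounded_linear g'" using g by (rule has_derivative_bounded_linear)
  then obtain Kg where Kg: "\<And>h. norm (g' h) \<le> norm h * Kg" using bounded_linear.bounded by blast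
  define KD where "KD = (Kg + K * norm (u t)) / c"
  have D_bound: "norm (D h) \<le> norm h * KD" for h
  proof -
    have "norm (D h) \<le> norm (g' h - M_dir h (u t)) / c" by (rule solution_bound[OF t D])
    also have "\<dots> \<le> (norm h * Kg + K * norm h * norm (u t)) / c"
      using norm_triangle_ineq4[of "g' h" "M_dir h (u t)"] Kg[of h] K(2)[of h "u t"] c_pos
      by (simp add: divide_le_cancel)
    also have "\<dots> = norm h * KD" by (simp add: KD_def algebra_simps)
    finally show ?thesis .
  qed
  have lin_D: "bounded_linear D"
  proof (rule bounded_linear_intro[OF _ _ D_bound])
    show "D (a + b) = D a + D b" for a b
      using solves_add[OF D[of a] D[of b]] D[of "a + b"]
      by (intro solves_unique[OF t]) (simp_all add: linear_simps[OF lin_g] M_dir_linear algebra_simps)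
    show "D (r *\<^sub>R a) = r *\<^sub>R D a" for r a
      using solves_scaleR[OF D[of a], of r] D[of "r *\<^sub>R a"]
      by (intro solves_unique[OF t]) (simp_all add: linear_simps[OF lin_g] M_dir_linear algebra_simps)
  qed
  show ?thesis
  proof (rule has_derivativeI_sandwich[OF zero_less_one lin_D])
    define H where "H s = norm (g s - g t - g' (s - t)) / norm (s - t) / c + K * norm (s - t) * KD / c" for s
    show "norm ((u s - u t) - D (s - t)) / norm (s - t) \<le> H s"
      if s: "s \<in> S" "s \<noteq> t" "dist s t < 1" for s
    proof -
      define h where "h = s - t"
      have "solves s (g s - (g t + M_dir h (u t)) - (g' h - M_dir h (u t) + M_dir h (D h))) ((u s - u t) - D h)"
        unfolding h_def by (intro solves_diff solves_shift u s t D)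
      then have "norm ((u s - u t) - D h) \<le>
          norm (g s - (g t + M_dir h (u t)) - (g' h - M_dir h (u t) + M_dir h (D h))) / c"
        by (rule solution_bound[OF s(1)])
      also have "\<dots> = norm ((g s - g t - g' h) - M_dir h (D h)) / c" by (simp add: algebra_simps)
      also have "\<dots> \<le> (norm (g s - g t - g' h) + K * norm h * (norm h * KD)) / c"
      proof -
        have "norm (M_dir h (D h)) \<le> K * norm h * (norm h * KD)"
          using K(2)[of h "D h"] mult_left_mono[OF D_bound[of h], of "K * norm h"] K(1) by simp
        then show ?thesis using norm_triangle_ineq4[of "g s - g t - g' h" "M_dir h (D h)"] c_pos
          by (simp add: divide_le_cancel)
      qed
      also have "\<dots> = H s * norm h" using s c_pos
        by (simp add: H_def h_def field_simps)
      finally show ?thesis using s by (simp add: h_def pos_divide_le_eq)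
    qed
    have "((\<lambda>s. norm (g s - g t - g' (s - t)) / norm (s - t)) \<longlongrightarrow> 0) (at t within S)"
      using g unfolding has_derivative_iff_norm by blast
    then have "(H \<longlongrightarrow> 0 / c + K * norm (t - t) * KD / c) (at t within S)"
      unfolding H_def using c_pos by (intro tendsto_intros) auto
    then show "(H \<longlongrightarrow> 0) (at t within S)" by simp
  qed
qed

text \<open>Induction on \<open>k\<close>: a directional derivative of \<open>u\<close> is the solution for the right-hand side
  \<open>g' h - M_dir h u\<close>, which is \<open>C\<^sup>k\<close> if \<open>g\<close> is \<open>C\<^sup>k\<^sup>+\<^sup>1\<close>, because \<open>u\<close> is \<open>C\<^sup>k\<close> by the induction hypothesis.\<close>

lemma C_k_on_solution:
  assumes "\<And>t. t \<in> S \<Longrightarrow> solves t (g t) (u t)" "C_k_on k S UNIV g"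
  shows "C_k_on k S V u"
  using assms
proof (induction k arbitrary: g u)
  case 0
  then show ?case using solution_continuous[of g u] by (auto simp: solves_def)
next
  case (Suc k)
  obtain g' where g': "\<And>t. t \<in> S \<Longrightarrow> (g has_derivative g' t) (at t within S)"
    "\<And>v. C_k_on k S UNIV (\<lambda>t. g' t v)" using Suc.prems(2) by auto
  have "C_k_on k S V u" using Suc.IH[OF Suc.prems(1)] C_k_on_SucD[OF Suc.prems(2)] by blast
  define D where "D t h = (SOME w. solves t (g' t h - M_dir h (u t)) w)" for t h
  have D: "solves t (g' t h - M_dir h (u t)) (D t h)" if "t \<in> S" for t h
    unfolding D_def using solution_exists[OF that] by (rule someI_ex)
  have "C_k_on k S V (\<lambda>t. D t h)" for h
  proof (rule Suc.IH)
    have "C_k_on k S UNIV (\<lambda>t. - M_dir h (u t))"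
      by (rule C_k_on_bounded_linear[OF bounded_linear_minus[OF bounded_linear_M_dir] \<open>C_k_on k S V u\<close>]) simp
    from C_k_on_add[OF g'(2) this] show "C_k_on k S UNIV (\<lambda>t. g' t h - M_dir h (u t))" by simp
  qed (rule D)
  moreover have "\<forall>t\<in>S. (u has_derivative D t) (at t within S)"
    using solution_has_derivative[OF _ Suc.prems(1) g'(1) D] by blast
  moreover have "u ` S \<subseteq> V" using Suc.prems(1) by (auto simp: solves_def)
  ultimately show ?case unfolding C_k_on.simps by blast
qed

end

section \<open>Completeness of \<open>L\<^sup>2\<close> and multiplication operators\<close>

lemma l2_eq_rep: "l2_eq (rep_l2 u) (rep_l2 u)"
  using Quotient_l2 by (rule Quotient_rep_reflp)

lemma square_integrable_rep: "square_integrable (rep_l2 u)"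
  using l2_eq_rep by (auto simp: l2_eq_def)

lemma rep_abs_l2: "square_integrable f \<Longrightarrow> AE x in lebesgue. rep_l2 (abs_l2 f) x = f x"
  using Quotient_rep_abs[OF Quotient_l2, of f] by (auto simp: l2_eq_def)

lemma l2_eqI: "AE x in lebesgue. rep_l2 u x = rep_l2 v x \<Longrightarrow> u = v"
  using Quotient_rel_rep[OF Quotient_l2, of u v] square_integrable_rep[of u] square_integrable_rep[of v]
  by (auto simp: l2_eq_def)

lemma abs_l2_eqI: "square_integrable f \<Longrightarrow> AE x in lebesgue. rep_l2 u x = f x \<Longrightarrow> abs_l2 f = u"
  by (rule l2_eqI) (use rep_abs_l2[of f] in auto)

lemma rep_plus_l2: "AE x in lebesgue. rep_l2 (u + v) x = rep_l2 u x + rep_l2 v x"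
  unfolding plus_l2_def map_fun_def
  by (auto intro!: rep_abs_l2 square_integrable_add square_integrable_rep)

lemma rep_minus_l2: "AE x in lebesgue. rep_l2 (u - v) x = rep_l2 u x - rep_l2 v x"
  unfolding minus_l2_def map_fun_def
  by (auto intro!: rep_abs_l2 square_integrable_diff square_integrable_rep)

lemma rep_scaleR_l2: "AE x in lebesgue. rep_l2 (c *\<^sub>R u) x = c *\<^sub>R rep_l2 u x"
  unfolding scaleR_l2_def map_fun_def
  by (auto intro!: rep_abs_l2 square_integrable_scaleR square_integrable_rep)

lemma inner_l2_rep: "u \<bullet> v = (\<integral>x. rep_l2 u x \<bullet> rep_l2 v x \<partial>lebesgue)"
  by (rule inner_l2.rep_eq)

lemma measurable_rep_l2 [measurable]: "rep_l2 u \<in> borel_measurable lebesgue"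
  using square_integrable_rep by (auto simp: square_integrable_def)

lemma nn_integral_rep_l2:
  "(\<integral>\<^sup>+x. ennreal ((norm (rep_l2 u x))\<^sup>2) \<partial>lebesgue) = ennreal ((norm u)\<^sup>2)"
proof -
  have "(\<integral>\<^sup>+x. ennreal ((norm (rep_l2 u x))\<^sup>2) \<partial>lebesgue)
      = ennreal (\<integral>x. (norm (rep_l2 u x))\<^sup>2 \<partial>lebesgue)"
    using square_integrable_rep[of u] by (intro nn_integral_eq_integral) (auto simp: square_integrable_def)
  then show ?thesis by (simp add: power2_norm_eq_inner inner_l2_rep)
qed

lemma nn_integral_rep_diff_l2:
  "(\<integral>\<^sup>+x. ennreal ((norm (rep_l2 u x - rep_l2 v x))\<^sup>2) \<partial>lebesgue) = ennreal ((norm (u - v))\<^sup>2)"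
  unfolding nn_integral_rep_l2[symmetric]
  by (rule nn_integral_cong_AE) (use rep_minus_l2[of u v] in auto)

lemma square_integrableI_nn_integral:
  assumes "f \<in> borel_measurable lebesgue" "(\<integral>\<^sup>+x. ennreal ((norm (f x))\<^sup>2) \<partial>lebesgue) < \<infinity>"
  shows "square_integrable f"
  using assms unfolding square_integrable_def by (auto intro!: integrableI_bounded)

text \<open>With \<open>d n\<close> the pointwise squared increments, \<open>\<integral> (\<Sum>n. 4^n * d n) \<le> \<Sum>n. 4^n * 16^-n\<close> is finite, so
  almost everywhere the increments themselves are at most a multiple of \<open>2^-n\<close>, hence summable.\<close>

lemma l2_AE_convergent:
  fixes X :: "nat \<Rightarrow> ('a::euclidean_space, 'b::euclidean_space) l2"
  assumes X: "\<And>n. norm (X (Suc n) - X n) \<le> (1/4) ^ n"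
  shows "AE x in lebesgue. convergent (\<lambda>n. rep_l2 (X n) x)"
proof -
  define d where "d n x = (norm (rep_l2 (X (Suc n)) x - rep_l2 (X n) x))\<^sup>2" for n x
  have [measurable]: "d n \<in> borel_measurable lebesgue" for n
    unfolding d_def by measurable
  have "(\<integral>\<^sup>+x. (\<Sum>n. ennreal (4 ^ n * d n x)) \<partial>lebesgue) = (\<Sum>n. \<integral>\<^sup>+x. ennreal (4 ^ n * d n x) \<partial>lebesgue)"
    by (rule nn_integral_suminf) measurable
  also have "\<dots> \<le> (\<Sum>n. ennreal ((1/4) ^ n))"
  proof (rule suminf_le)
    fix n
    have "(\<integral>\<^sup>+x. ennreal (4 ^ n * d n x) \<partial>lebesgue) = ennreal (4 ^ n) * (\<integral>\<^sup>+x. ennreal (d n x) \<partial>lebesgue)"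
      by (simp add: ennreal_mult' nn_integral_cmult)
    also have "\<dots> = ennreal (4 ^ n * (norm (X (Suc n) - X n))\<^sup>2)"
      unfolding d_def nn_integral_rep_diff_l2 by (simp add: ennreal_mult')
    also have "\<dots> \<le> ennreal (4 ^ n * ((1/4) ^ n)\<^sup>2)"
      by (intro ennreal_leI mult_left_mono power_mono X) auto
    also have "4 ^ n * ((1/4::real) ^ n)\<^sup>2 = (1/4) ^ n"
      by (simp add: power2_eq_square power_divide field_simps)
    finally show "(\<integral>\<^sup>+x. ennreal (4 ^ n * d n x) \<partial>lebesgue) \<le> ennreal ((1/4) ^ n)" .
  qed auto
  also have "\<dots> = ennreal (\<Sum>n. (1/4) ^ n)"
    by (intro suminf_ennreal2 summable_geometric) auto
  also have "\<dots> < \<infinity>" by simp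
  finally have "(\<integral>\<^sup>+x. (\<Sum>n. ennreal (4 ^ n * d n x)) \<partial>lebesgue) \<noteq> \<infinity>" by simp
  then have "AE x in lebesgue. (\<Sum>n. ennreal (4 ^ n * d n x)) \<noteq> \<infinity>"
    by (intro nn_integral_PInf_AE) auto
  then show ?thesis
  proof eventually_elim
    fix x assume "(\<Sum>n. ennreal (4 ^ n * d n x)) \<noteq> \<infinity>"
    then have sm: "summable (\<lambda>n. 4 ^ n * d n x)"
      by (intro summable_suminf_not_top) (auto simp: d_def)
    define K where "K = (\<Sum>n. 4 ^ n * d n x)"
    have bound: "norm (rep_l2 (X (Suc n)) x - rep_l2 (X n) x) \<le> sqrt K * (1/2) ^ n" for n
    proof (rule power2_le_imp_le)
      have "4 ^ n * d n x \<le> K"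
        unfolding K_def using sum_le_suminf[OF sm, of "{n}"] by (simp add: d_def)
      moreover have "K \<ge> 0" unfolding K_def by (rule suminf_nonneg[OF sm]) (simp add: d_def)
      moreover have "((1/2::real) ^ n)\<^sup>2 = 1 / 4 ^ n"
      proof -
        have "((1/2::real) ^ n)\<^sup>2 = ((1/2)\<^sup>2) ^ n"
          by (simp only: power_mult[symmetric] mult.commute)
        then show ?thesis by (simp add: power_divide)
      qed
      ultimately have "d n x \<le> (sqrt K * (1/2) ^ n)\<^sup>2"
        by (simp add: power_mult_distrib pos_le_divide_eq mult.commute)
      then show "(norm (rep_l2 (X (Suc n)) x - rep_l2 (X n) x))\<^sup>2 \<le> (sqrt K * (1/2) ^ n)\<^sup>2"
        by (simp only: d_def)
      show "0 \<le> sqrt K * (1/2) ^ n" using \<open>K \<ge> 0\<close> by simp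
    qed
    have "summable (\<lambda>n. sqrt K * (1/2::real) ^ n)"
      by (rule summable_mult, rule summable_geometric) simp
    then have "summable (\<lambda>n. rep_l2 (X (Suc n)) x - rep_l2 (X n) x)"
      by (rule summable_comparison_test'[where N = 0]) (rule bound)
    then have "convergent (\<lambda>n. \<Sum>i<n. rep_l2 (X (Suc i)) x - rep_l2 (X i) x)"
      by (simp add: summable_iff_convergent)
    then have "convergent (\<lambda>n. (rep_l2 (X n) x - rep_l2 (X 0) x) + rep_l2 (X 0) x)"
      unfolding sum_lessThan_telescope[of "\<lambda>n. rep_l2 (X n) x"] by (intro convergent_add convergent_const)
    then show "convergent (\<lambda>n. rep_l2 (X n) x)" by simp
  qed
qed

text \<open>Fatou's lemma transfers the Cauchy bound to the pointwise limit: the distance of the limit to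
  \<open>X n\<close> is at most the lower limit of the distances of \<open>X m\<close> to \<open>X n\<close>.\<close>

lemma Cauchy_l2_limit_of_AE_limit:
  fixes X :: "nat \<Rightarrow> ('a::euclidean_space, 'b::euclidean_space) l2"
  assumes "Cauchy X" and "f \<in> borel_measurable lebesgue"
    and lim: "AE x in lebesgue. (\<lambda>n. rep_l2 (X n) x) \<longlonglongrightarrow> f x"
  shows "convergent X"
proof -
  note [measurable] = assms(2)
  have Fatou: "(\<integral>\<^sup>+x. ennreal ((norm (f x - rep_l2 (X n) x))\<^sup>2) \<partial>lebesgue) \<le> ennreal (e\<^sup>2)"
    if e: "\<And>m. m \<ge> N \<Longrightarrow> norm (X m - X n) \<le> e" for n N e
  proof -
    have "(\<integral>\<^sup>+x. ennreal ((norm (f x - rep_l2 (X n) x))\<^sup>2) \<partial>lebesgue)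
        = (\<integral>\<^sup>+x. liminf (\<lambda>m. ennreal ((norm (rep_l2 (X m) x - rep_l2 (X n) x))\<^sup>2)) \<partial>lebesgue)"
    proof (rule nn_integral_cong_AE, use lim in eventually_elim)
      fix x assume "(\<lambda>n. rep_l2 (X n) x) \<longlonglongrightarrow> f x"
      then have "(\<lambda>m. ennreal ((norm (rep_l2 (X m) x - rep_l2 (X n) x))\<^sup>2))
          \<longlonglongrightarrow> ennreal ((norm (f x - rep_l2 (X n) x))\<^sup>2)"
        by (intro tendsto_intros tendsto_ennrealI)
      then show "ennreal ((norm (f x - rep_l2 (X n) x))\<^sup>2)
          = liminf (\<lambda>m. ennreal ((norm (rep_l2 (X m) x - rep_l2 (X n) x))\<^sup>2))"
        by (rule lim_imp_Liminf[OF sequentially_bot, symmetric])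
    qed
    also have "\<dots> \<le> liminf (\<lambda>m. \<integral>\<^sup>+x. ennreal ((norm (rep_l2 (X m) x - rep_l2 (X n) x))\<^sup>2) \<partial>lebesgue)"
      by (rule nn_integral_liminf) measurable
    also have "\<dots> = liminf (\<lambda>m. ennreal ((norm (X m - X n))\<^sup>2))"
      by (simp add: nn_integral_rep_diff_l2)
    also have "\<dots> \<le> liminf (\<lambda>m. ennreal (e\<^sup>2))"
      by (rule Liminf_mono) (auto simp: eventually_sequentially intro!: exI[of _ N] ennreal_leI power_mono e)
    also have "\<dots> = ennreal (e\<^sup>2)" by (rule Liminf_const) simp
    finally show ?thesis .
  qed
  have e2: "\<exists>N. \<forall>m\<ge>N. \<forall>n\<ge>N. norm (X m - X n) \<le> e" if "e > 0" for e
    using metric_CauchyD[OF assms(1) that] by (auto simp: dist_norm intro: less_imp_le)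
  obtain N where N: "\<And>m n. m \<ge> N \<Longrightarrow> n \<ge> N \<Longrightarrow> norm (X m - X n) \<le> 1" using e2[of 1] by auto
  have "square_integrable (\<lambda>x. f x - rep_l2 (X N) x)"
    using Fatou[of N N 1] N by (intro square_integrableI_nn_integral) (auto intro: le_less_trans)
  from square_integrable_add[OF this square_integrable_rep[of "X N"]]
  have sq: "square_integrable f" by simp
  have "X \<longlonglongrightarrow> abs_l2 f"
  proof (rule metric_LIMSEQ_I)
    fix r :: real assume "r > 0"
    then obtain M where M: "\<And>m n. m \<ge> M \<Longrightarrow> n \<ge> M \<Longrightarrow> norm (X m - X n) \<le> r / 2"
      using e2[of "r/2"] by auto
    have "dist (X n) (abs_l2 f) < r" if "n \<ge> M" for n
    proof -
      have "ennreal ((norm (abs_l2 f - X n))\<^sup>2) = (\<integral>\<^sup>+x. ennreal ((norm (f x - rep_l2 (X n) x))\<^sup>2) \<partial>lebesgue)"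
        unfolding nn_integral_rep_diff_l2[symmetric]
        by (rule nn_integral_cong_AE) (use rep_abs_l2[OF sq] in auto)
      also have "\<dots> \<le> ennreal ((r/2)\<^sup>2)" using Fatou[of M n "r/2"] M that by auto
      finally have "(norm (abs_l2 f - X n))\<^sup>2 \<le> (r/2)\<^sup>2" by (subst (asm) ennreal_le_iff) auto
      then have "norm (abs_l2 f - X n) \<le> r/2"
        by (rule power2_le_imp_le) (use \<open>r > 0\<close> in simp)
      then show ?thesis using \<open>r > 0\<close> by (simp add: dist_norm norm_minus_commute)
    qed
    then show "\<exists>M. \<forall>n\<ge>M. dist (X n) (abs_l2 f) < r" by blast
  qed
  then show ?thesis by (auto simp: convergent_def)
qed

text \<open>The Riesz-Fischer theorem.\<close>

instance l2 :: (euclidean_space, euclidean_space) complete_space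
proof
  fix X :: "nat \<Rightarrow> ('a, 'b) l2"
  assume X: "Cauchy X"
  have "\<exists>N. \<forall>m\<ge>N. \<forall>n\<ge>N. norm (X m - X n) < (1/4) ^ k" for k
    using metric_CauchyD[OF X, of "(1/4) ^ k"] by (auto simp: dist_norm)
  then obtain N where N: "\<And>k m n. m \<ge> N k \<Longrightarrow> n \<ge> N k \<Longrightarrow> norm (X m - X n) < (1/4) ^ k" by metis
  \<comment> \<open>The summand \<open>k\<close> makes \<open>r\<close> strictly increasing even if all \<open>N j\<close> vanish.\<close>
  define r where "r k = (\<Sum>j\<le>k. N j) + k" for k
  have "strict_mono r" unfolding strict_mono_Suc_iff by (simp add: r_def)
  have r: "r k \<ge> N k" for k unfolding r_def by (simp add: member_le_sum trans_le_add1)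
  have "norm (X (r (Suc k)) - X (r k)) \<le> (1/4) ^ k" for k
    using N[of k "r (Suc k)" "r k"] r[of k] \<open>strict_mono r\<close>
    by (metis less_imp_le order_trans strict_mono_less_eq le_SucI order_refl)
  from l2_AE_convergent[of "X \<circ> r"] this
  have "AE x in lebesgue. convergent (\<lambda>n. rep_l2 (X (r n)) x)" by simp
  then have "AE x in lebesgue. (\<lambda>n. rep_l2 ((X \<circ> r) n) x) \<longlonglongrightarrow> lim (\<lambda>n. rep_l2 (X (r n)) x)"
    by eventually_elim (simp add: convergent_LIMSEQ_iff)
  moreover have "(\<lambda>x. lim (\<lambda>n. rep_l2 (X (r n)) x)) \<in> borel_measurable lebesgue" by measurable
  ultimately have "convergent (X \<circ> r)"
    using Cauchy_l2_limit_of_AE_limit Cauchy_subseq_Cauchy[OF X \<open>strict_mono r\<close>] by blast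
  then obtain l where "(X \<circ> r) \<longlonglongrightarrow> l" by (auto simp: convergent_def)
  from Cauchy_converges_subseq[OF X \<open>strict_mono r\<close> this] show "convergent X"
    by (auto simp: convergent_def)
qed

lemma multiplier_square_integrable:
  assumes "m \<in> borel_measurable lebesgue" "AE x in lebesgue. \<bar>m x\<bar> \<le> B" "square_integrable f"
  shows "square_integrable (\<lambda>x. m x *\<^sub>R f x)"
  unfolding square_integrable_def
proof
  show "(\<lambda>x. m x *\<^sub>R f x) \<in> borel_measurable lebesgue"
    using assms by (auto simp: square_integrable_def)
  show "integrable lebesgue (\<lambda>x. (norm (m x *\<^sub>R f x))\<^sup>2)"
  proof (rule Bochner_Integration.integrable_bound)
    show "integrable lebesgue (\<lambda>x. B\<^sup>2 * (norm (f x))\<^sup>2)" using assms(3) by (auto simp: square_integrable_def)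
    show "(\<lambda>x. (norm (m x *\<^sub>R f x))\<^sup>2) \<in> borel_measurable lebesgue"
      using assms by (auto simp: square_integrable_def)
    show "AE x in lebesgue. norm ((norm (m x *\<^sub>R f x))\<^sup>2) \<le> norm (B\<^sup>2 * (norm (f x))\<^sup>2)"
      using assms(2)
    proof eventually_elim
      fix x assume "\<bar>m x\<bar> \<le> B"
      then have "\<bar>m x\<bar>\<^sup>2 \<le> B\<^sup>2" by (intro power_mono) auto
      then show "norm ((norm (m x *\<^sub>R f x))\<^sup>2) \<le> norm (B\<^sup>2 * (norm (f x))\<^sup>2)"
        by (simp add: power_mult_distrib mult_right_mono)
    qed
  qed
qed

text \<open>Multiplication operators turn the lower-order term of the equation and the restriction of
  integrals to the domain into bounded operators on \<open>L\<^sup>2\<close>.\<close>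

definition multiplier :: "('a::euclidean_space \<Rightarrow> real) \<Rightarrow> ('a, 'b::euclidean_space) l2 \<Rightarrow> ('a, 'b) l2"
  where "multiplier m u = abs_l2 (\<lambda>x. m x *\<^sub>R rep_l2 u x)"

lemma
  assumes m: "m \<in> borel_measurable lebesgue" "AE x in lebesgue. \<bar>m x\<bar> \<le> B"
  shows rep_multiplier: "AE x in lebesgue. rep_l2 (multiplier m u) x = m x *\<^sub>R rep_l2 u x"
    and bounded_linear_multiplier: "bounded_linear (multiplier m)"
    and inner_multiplier: "multiplier m u \<bullet> v = (\<integral>x. m x * (rep_l2 u x \<bullet> rep_l2 v x) \<partial>lebesgue)"
proof -
  show rep: "AE x in lebesgue. rep_l2 (multiplier m u) x = m x *\<^sub>R rep_l2 u x" for u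
    unfolding multiplier_def
    by (intro rep_abs_l2 multiplier_square_integrable[OF m] square_integrable_rep)
  show "multiplier m u \<bullet> v = (\<integral>x. m x * (rep_l2 u x \<bullet> rep_l2 v x) \<partial>lebesgue)" for u v
    unfolding inner_l2_rep
    by (rule integral_cong_AE) (use rep[of u] m(1) in auto)
  show "bounded_linear (multiplier m)"
  proof (rule bounded_linear_intro)
    show "multiplier m (u + v) = multiplier m u + multiplier m v" for u v
    proof (rule l2_eqI)
      show "AE x in lebesgue. rep_l2 (multiplier m (u + v)) x = rep_l2 (multiplier m u + multiplier m v) x"
        using rep[of "u + v"] rep[of u] rep[of v] rep_plus_l2[of u v]
          rep_plus_l2[of "multiplier m u" "multiplier m v"]
        by eventually_elim (simp add: scaleR_add_right)
    qed
    show "multiplier m (c *\<^sub>R u) = c *\<^sub>R multiplier m u" for c u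
    proof (rule l2_eqI)
      show "AE x in lebesgue. rep_l2 (multiplier m (c *\<^sub>R u)) x = rep_l2 (c *\<^sub>R multiplier m u) x"
        using rep[of "c *\<^sub>R u"] rep[of u] rep_scaleR_l2[of c u] rep_scaleR_l2[of c "multiplier m u"]
        by eventually_elim simp
    qed
    show "norm (multiplier m u) \<le> norm u * \<bar>B\<bar>" for u
    proof (rule power2_le_imp_le)
      have "ennreal ((norm (multiplier m u))\<^sup>2) \<le> (\<integral>\<^sup>+x. ennreal (B\<^sup>2) * ennreal ((norm (rep_l2 u x))\<^sup>2) \<partial>lebesgue)"
        unfolding nn_integral_rep_l2[symmetric]
      proof (rule nn_integral_mono_AE, use m(2) rep[of u] in eventually_elim)
        fix x assume *: "\<bar>m x\<bar> \<le> B" "rep_l2 (multiplier m u) x = m x *\<^sub>R rep_l2 u x"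
        then have "\<bar>m x\<bar>\<^sup>2 \<le> B\<^sup>2" by (intro power_mono) auto
        then show "ennreal ((norm (rep_l2 (multiplier m u) x))\<^sup>2) \<le> ennreal (B\<^sup>2) * ennreal ((norm (rep_l2 u x))\<^sup>2)"
          by (simp add: * power_mult_distrib mult_right_mono ennreal_mult'[symmetric])
      qed
      also have "\<dots> = ennreal ((norm u * \<bar>B\<bar>)\<^sup>2)"
        by (subst nn_integral_cmult)
          (simp_all add: nn_integral_rep_l2 power_mult_distrib mult.commute ennreal_mult'[symmetric])
      finally show "(norm (multiplier m u))\<^sup>2 \<le> (norm u * \<bar>B\<bar>)\<^sup>2" by (subst (asm) ennreal_le_iff) auto
    qed simp
  qed
qed

section \<open>The space \<open>H\<^sub>0\<^sup>1\<close>\<close>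

lemma square_integrable_continuous_compact_support:
  fixes f :: "'a::euclidean_space \<Rightarrow> 'b::euclidean_space"
  assumes f: "continuous_on UNIV f" and K: "compact K" and zero: "\<And>x. x \<notin> K \<Longrightarrow> f x = 0"
  shows "square_integrable f"
proof -
  have "f \<in> borel_measurable borel" by (rule borel_measurable_continuous_onI[OF f])
  then have meas: "f \<in> borel_measurable lborel" by simp
  have "integrable lborel (\<lambda>x. indicator K x *\<^sub>R (norm (f x))\<^sup>2)"
    by (rule borel_integrable_compact[OF K])
      (intro continuous_intros continuous_on_subset[OF f] subset_UNIV)
  also have "(\<lambda>x. indicator K x *\<^sub>R (norm (f x))\<^sup>2) = (\<lambda>x. (norm (f x))\<^sup>2)"
    using zero by (auto simp: indicator_def fun_eq_iff)
  finally have "integrable lebesgue (\<lambda>x. (norm (f x))\<^sup>2)"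
    using meas by (subst integrable_completion) auto
  then show ?thesis using meas by (simp add: square_integrable_def measurable_completion)
qed

text \<open>Off the support of \<open>\<phi>\<close> the gradient vanishes because the complement of the support is open. The
  gradient is continuous since its components are directional derivatives of a \<open>C\<^sup>1\<close> function.\<close>

lemma
  assumes \<phi>: "test_function \<Omega> \<phi>" and g: "\<And>x. GDERIV \<phi> x :> g x"
  shows test_function_square_integrable: "square_integrable \<phi>"
    and test_gradient_square_integrable: "square_integrable g"
    and test_function_support: "x \<notin> \<Omega> \<Longrightarrow> \<phi> x = 0"
    and test_gradient_support: "x \<notin> \<Omega> \<Longrightarrow> g x = 0"
proof -
  define K where "K = closure {x. \<phi> x \<noteq> 0}"
  have K: "compact K" "K \<subseteq> \<Omega>" using \<phi> by (auto simp: test_function_def K_def)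
  have \<phi>0: "\<phi> x = 0" if "x \<notin> K" for x using that closure_subset by (force simp: K_def)
  have g0: "g x = 0" if "x \<notin> K" for x
  proof -
    have "((\<lambda>_. 0) has_derivative (\<lambda>h. h \<bullet> g x)) (at x)"
    proof (rule has_derivative_transform_within_open)
      show "(\<phi> has_derivative (\<lambda>h. h \<bullet> g x)) (at x)" using g by (simp add: gderiv_def)
      show "open (- K)" using K(1) by (simp add: compact_imp_closed open_Compl)
    qed (use that \<phi>0 in auto)
    from has_derivative_unique[OF this has_derivative_const]
    have "g x \<bullet> g x = 0" by (metis (no_types))
    then show ?thesis by simp
  qed
  have "C_k_on 1 UNIV UNIV \<phi>" using \<phi> by (simp add: test_function_def)
  then obtain \<phi>' where \<phi>': "\<And>x. (\<phi> has_derivative \<phi>' x) (at x)" "\<And>v. continuous_on UNIV (\<lambda>x. \<phi>' x v)"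
    by auto
  have "\<phi>' x = (\<lambda>h. h \<bullet> g x)" for x
    using has_derivative_unique[OF \<phi>'(1)] g by (simp add: gderiv_def)
  then have "(\<lambda>x. \<Sum>b\<in>Basis. \<phi>' x b *\<^sub>R b) = g"
    by (simp add: fun_eq_iff inner_commute[of _ "g _"] euclidean_representation)
  moreover have "continuous_on UNIV (\<lambda>x. \<Sum>b\<in>Basis. \<phi>' x b *\<^sub>R b)"
    by (intro continuous_intros \<phi>')
  ultimately have "continuous_on UNIV g" by (simp only:)
  then show "square_integrable g"
    using g0 by (rule square_integrable_continuous_compact_support[OF _ K(1)])
  have "continuous_on UNIV \<phi>"
    using \<phi>'(1) by (intro continuous_at_imp_continuous_on) (auto intro: has_derivative_continuous)
  then show "square_integrable \<phi>"
    using \<phi>0 by (rule square_integrable_continuous_compact_support[OF _ K(1)])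
  show "\<phi> x = 0" "g x = 0" if "x \<notin> \<Omega>" using that K(2) \<phi>0 g0 by auto
qed

lemma test_function_zero: "test_function \<Omega> (\<lambda>_. 0)"
  by (simp add: test_function_def C_k_on_zero)

lemma test_function_add:
  assumes "test_function \<Omega> \<phi>" "test_function \<Omega> \<psi>"
  shows "test_function \<Omega> (\<lambda>x. \<phi> x + \<psi> x)"
proof -
  have sub: "closure {x. \<phi> x + \<psi> x \<noteq> 0} \<subseteq> closure {x. \<phi> x \<noteq> 0} \<union> closure {x. \<psi> x \<noteq> 0}"
    unfolding closure_Un[symmetric] by (rule closure_mono) auto
  have "compact (closure {x. \<phi> x \<noteq> 0} \<union> closure {x. \<psi> x \<noteq> 0})"
    using assms by (auto simp: test_function_def intro: compact_Un)
  from compact_Int_closed[OF this closed_closure[of "{x. \<phi> x + \<psi> x \<noteq> 0}"]] sub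
  have "compact (closure {x. \<phi> x + \<psi> x \<noteq> 0})" by (simp add: Int_absorb1)
  moreover have "C_k_on k UNIV UNIV (\<lambda>x. \<phi> x + \<psi> x)" for k
    using assms by (intro C_k_on_add) (auto simp: test_function_def)
  ultimately show ?thesis using assms sub unfolding test_function_def by blast
qed

lemma test_function_scale:
  assumes "test_function \<Omega> \<phi>"
  shows "test_function \<Omega> (\<lambda>x. c * \<phi> x)"
proof -
  have sub: "closure {x. c * \<phi> x \<noteq> 0} \<subseteq> closure {x. \<phi> x \<noteq> 0}"
    by (rule closure_mono) auto
  have "compact (closure {x. \<phi> x \<noteq> 0})" using assms by (simp add: test_function_def)
  from compact_Int_closed[OF this closed_closure[of "{x. c * \<phi> x \<noteq> 0}"]] sub
  have "compact (closure {x. c * \<phi> x \<noteq> 0})" by (simp add: Int_absorb1)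
  moreover have "C_k_on k UNIV UNIV (\<lambda>x. c * \<phi> x)" for k
    using assms by (intro C_k_on_bounded_linear[OF bounded_linear_mult_right, of _ _ UNIV])
      (auto simp: test_function_def)
  ultimately show ?thesis using assms sub unfolding test_function_def by blast
qed

lemma abs_l2_plus: "square_integrable f \<Longrightarrow> square_integrable g \<Longrightarrow> abs_l2 f + abs_l2 g = abs_l2 (\<lambda>x. f x + g x)"
  by (rule abs_l2_eqI[symmetric], erule (1) square_integrable_add)
    (use rep_plus_l2[of "abs_l2 f" "abs_l2 g"] rep_abs_l2[of f] rep_abs_l2[of g] in auto)

lemma abs_l2_scaleR: "square_integrable f \<Longrightarrow> c *\<^sub>R abs_l2 f = abs_l2 (\<lambda>x. c *\<^sub>R f x)"
  by (rule abs_l2_eqI[symmetric], erule square_integrable_scaleR)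
    (use rep_scaleR_l2[of c "abs_l2 f"] rep_abs_l2[of f] in auto)

definition test_space :: "'a::euclidean_space set \<Rightarrow> 'a h1 set" where
  "test_space \<Omega> = {(abs_l2 \<phi>, abs_l2 g) | \<phi> g. test_function \<Omega> \<phi> \<and> (\<forall>x. GDERIV \<phi> x :> g x)}"

lemma H01_eq_closure: "H01 \<Omega> = closure (test_space \<Omega>)"
  by (simp add: H01_def test_space_def)

lemma subspace_test_space: "subspace (test_space \<Omega>)"
proof (rule subspaceI)
  have "GDERIV (\<lambda>_. 0) x :> 0" for x :: 'a by (simp add: gderiv_def)
  then show "0 \<in> test_space \<Omega>"
    using test_function_zero unfolding test_space_def zero_prod_def zero_l2_def by blast
next
  fix u v :: "'a h1" assume "u \<in> test_space \<Omega>" "v \<in> test_space \<Omega>"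
  then obtain \<phi> g \<psi> h where u: "u = (abs_l2 \<phi>, abs_l2 g)" "test_function \<Omega> \<phi>" "\<And>x. GDERIV \<phi> x :> g x"
    and v: "v = (abs_l2 \<psi>, abs_l2 h)" "test_function \<Omega> \<psi>" "\<And>x. GDERIV \<psi> x :> h x"
    unfolding test_space_def by auto
  have "u + v = (abs_l2 (\<lambda>x. \<phi> x + \<psi> x), abs_l2 (\<lambda>x. g x + h x))"
    using test_function_square_integrable[OF u(2,3)] test_function_square_integrable[OF v(2,3)]
      test_gradient_square_integrable[OF u(2,3)] test_gradient_square_integrable[OF v(2,3)]
    by (simp add: u(1) v(1) abs_l2_plus)
  then show "u + v \<in> test_space \<Omega>"
    using test_function_add[OF u(2) v(2)] GDERIV_add[OF u(3) v(3)] unfolding test_space_def by blast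
next
  fix c :: real and u :: "'a h1" assume "u \<in> test_space \<Omega>"
  then obtain \<phi> g where u: "u = (abs_l2 \<phi>, abs_l2 g)" "test_function \<Omega> \<phi>" "\<And>x. GDERIV \<phi> x :> g x"
    unfolding test_space_def by auto
  have "GDERIV (\<lambda>x. c * \<phi> x) x :> c *\<^sub>R g x" for x
    using u(3)[of x] has_derivative_mult_right[of \<phi> "\<lambda>h. h \<bullet> g x" "at x" c] by (simp add: gderiv_def)
  moreover have "c *\<^sub>R u = (abs_l2 (\<lambda>x. c * \<phi> x), abs_l2 (\<lambda>x. c *\<^sub>R g x))"
    using abs_l2_scaleR[OF test_function_square_integrable[OF u(2,3)], of c]
      abs_l2_scaleR[OF test_gradient_square_integrable[OF u(2,3)], of c]
    by (simp add: u(1))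
  ultimately show "c *\<^sub>R u \<in> test_space \<Omega>"
    using test_function_scale[OF u(2)] unfolding test_space_def by blast
qed

lemma subspace_closure:
  fixes W :: "'a::real_normed_vector set"
  assumes "subspace W" shows "subspace (closure W)"
proof (rule subspaceI)
  show "0 \<in> closure W" using subspace_0[OF assms] closure_subset by blast
next
  fix x y assume "x \<in> closure W" "y \<in> closure W"
  then obtain f g where "\<forall>n. f n \<in> W" "f \<longlonglongrightarrow> x" "\<forall>n. g n \<in> W" "g \<longlonglongrightarrow> y"
    unfolding closure_sequential by blast
  then show "x + y \<in> closure W"
    unfolding closure_sequential using tendsto_add[of f x sequentially g y] subspace_add[OF assms]
    by (intro exI[of _ "\<lambda>n. f n + g n"]) auto
next
  fix c x assume "x \<in> closure W"
  then obtain f where "\<forall>n. f n \<in> W" "f \<longlonglongrightarrow> x"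
    unfolding closure_sequential by blast
  then show "c *\<^sub>R x \<in> closure W"
    unfolding closure_sequential using tendsto_scaleR[OF tendsto_const, of f x sequentially c]
      subspace_scale[OF assms]
    by (intro exI[of _ "\<lambda>n. c *\<^sub>R f n"]) auto
qed

lemma subspace_H01: "subspace (H01 \<Omega>)"
  unfolding H01_eq_closure by (rule subspace_closure[OF subspace_test_space])

lemma complete_H01: "complete (H01 \<Omega>)"
  unfolding complete_eq_closed H01_def by simp

lemma indicator_multiplier:
  assumes "\<Omega> \<in> sets lebesgue"
  shows "(indicator \<Omega> :: 'a::euclidean_space \<Rightarrow> real) \<in> borel_measurable lebesgue"
    and "AE x in lebesgue. \<bar>indicator \<Omega> x :: real\<bar> \<le> 1"
  using assms by (auto simp: indicator_def)

text \<open>Elements of \<open>H01 \<Omega>\<close> and their gradients vanish almost everywhere outside \<open>\<Omega>\<close>: test functions do,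
  and the fixed points of the bounded operator "multiply by the indicator of \<open>\<Omega>\<close>" form a closed
  set. Hence the norm of the whole space, used for \<open>H01 \<Omega>\<close>, sees only integrals over \<open>\<Omega>\<close>.\<close>

lemma H01_restrict:
  assumes \<Omega>: "\<Omega> \<in> sets lebesgue" and u: "u \<in> H01 \<Omega>"
  shows "multiplier (indicator \<Omega>) (fst u) = fst u" "multiplier (indicator \<Omega>) (snd u) = snd u"
proof -
  let ?Z = "{u :: 'a h1. multiplier (indicator \<Omega>) (fst u) = fst u \<and> multiplier (indicator \<Omega>) (snd u) = snd u}"
  note cont = bounded_linear.continuous_on[OF bounded_linear_multiplier[OF indicator_multiplier[OF \<Omega>]]]
  have vanish: "multiplier (indicator \<Omega>) (abs_l2 f) = abs_l2 f"
    if f: "square_integrable f" "\<And>x. x \<notin> \<Omega> \<Longrightarrow> f x = 0" for f :: "'a \<Rightarrow> 'b::euclidean_space"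
  proof (rule l2_eqI)
    show "AE x in lebesgue. rep_l2 (multiplier (indicator \<Omega>) (abs_l2 f)) x = rep_l2 (abs_l2 f) x"
      using rep_multiplier[OF indicator_multiplier[OF \<Omega>], of "abs_l2 f"] rep_abs_l2[OF f(1)]
      by eventually_elim (use f(2) in \<open>simp split: split_indicator\<close>)
  qed
  have "closed ?Z"
    by (intro closed_Collect_conj closed_Collect_eq continuous_intros cont)
  moreover have "test_space \<Omega> \<subseteq> ?Z"
  proof
    fix w assume "w \<in> test_space \<Omega>"
    then obtain \<phi> g where w: "w = (abs_l2 \<phi>, abs_l2 g)" "test_function \<Omega> \<phi>" "\<And>x. GDERIV \<phi> x :> g x"
      unfolding test_space_def by auto
    show "w \<in> ?Z"
      using vanish[OF test_function_square_integrable[OF w(2,3)] test_function_support[OF w(2,3)]]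
        vanish[OF test_gradient_square_integrable[OF w(2,3)] test_gradient_support[OF w(2,3)]]
      by (simp add: w(1))
  qed
  ultimately have "H01 \<Omega> \<subseteq> ?Z" unfolding H01_eq_closure by (rule closure_minimal[rotated])
  with u show "multiplier (indicator \<Omega>) (fst u) = fst u" "multiplier (indicator \<Omega>) (snd u) = snd u"
    by auto
qed

text \<open>The coefficient is bounded for almost every pair \<open>(x, t)\<close>, but the weak formulation needs the
  bounds for every \<open>t\<close>. By Fubini, for almost every \<open>x\<close> they hold for almost every \<open>t\<close>; as \<open>F x\<close> is
  continuous in \<open>t\<close>, the set of such \<open>t\<close> is closed, so it contains the open box and its closure.
  The exceptional set of points \<open>x\<close> does not depend on \<open>t\<close>.\<close>

lemma AE_pair_imp_all_parameters:
  fixes F :: "'a::euclidean_space \<Rightarrow> 'b::euclidean_space \<Rightarrow> real"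
  assumes \<Omega>: "open \<Omega>" and box: "box a b \<noteq> {}"
    and cont: "\<And>x. continuous_on UNIV (F x)"
    and ae: "AE (x, t) in lebesgue_on (\<Omega> \<times> cbox a b). l \<le> F x t \<and> F x t \<le> r"
  shows "AE x in lebesgue. x \<in> \<Omega> \<longrightarrow> (\<forall>t\<in>cbox a b. l \<le> F x t \<and> F x t \<le> r)"
proof -
  have "open (\<Omega> \<times> (UNIV :: 'b set))" "closed ((UNIV :: 'a set) \<times> cbox a b)"
    using \<Omega> by (blast intro: open_Times open_UNIV closed_Times closed_UNIV closed_cbox)+
  then have "\<Omega> \<times> UNIV \<inter> UNIV \<times> cbox a b \<in> sets borel" by (intro sets.Int borel_open borel_closed)
  then have "\<Omega> \<times> cbox a b \<in> sets borel" by (simp add: Times_Int_Times)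
  then have "AE p in lebesgue. p \<in> \<Omega> \<times> cbox a b \<longrightarrow> (case p of (x, t) \<Rightarrow> l \<le> F x t \<and> F x t \<le> r)"
    using ae by (subst (asm) AE_restrict_space_iff) auto
  then have "AE p in lborel \<Otimes>\<^sub>M lborel. p \<in> \<Omega> \<times> cbox a b \<longrightarrow> (case p of (x, t) \<Rightarrow> l \<le> F x t \<and> F x t \<le> r)"
    unfolding AE_completion_iff lborel_prod .
  from AE_completion[OF lborel_pair.AE_pair[OF this]]
  have "AE x in lebesgue. AE t in lborel. (x, t) \<in> \<Omega> \<times> cbox a b \<longrightarrow> l \<le> F x t \<and> F x t \<le> r"
    by simp
  then show ?thesis
  proof eventually_elim
    fix x assume *: "AE t in lborel. (x, t) \<in> \<Omega> \<times> cbox a b \<longrightarrow> l \<le> F x t \<and> F x t \<le> r"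
    show "x \<in> \<Omega> \<longrightarrow> (\<forall>t\<in>cbox a b. l \<le> F x t \<and> F x t \<le> r)"
    proof
      assume x: "x \<in> \<Omega>"
      let ?C = "{t. l \<le> F x t \<and> F x t \<le> r}"
      have C: "closed ?C" by (intro closed_Collect_conj closed_Collect_le cont continuous_intros)
      have "AE t \<in> box a b in lebesgue. t \<in> ?C"
        using AE_completion[OF *] by eventually_elim (use x box_subset_cbox in auto)
      then have "box a b \<subseteq> ?C" using mem_closed_if_AE_lebesgue_open[OF open_box C] by blast
      from closure_minimal[OF this C] box show "\<forall>t\<in>cbox a b. l \<le> F x t \<and> F x t \<le> r" by auto
    qed
  qed
qed

lemma restrict_L_infinity:
  assumes \<Omega>: "\<Omega> \<in> sets lebesgue" and m: "m \<in> L_infinity \<Omega>"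
  shows "(\<lambda>x. indicator \<Omega> x * m x) \<in> borel_measurable lebesgue"
    and "\<exists>B. AE x in lebesgue. \<bar>indicator \<Omega> x * m x\<bar> \<le> B"
proof -
  show "(\<lambda>x. indicator \<Omega> x * m x) \<in> borel_measurable lebesgue"
    using m borel_measurable_restrict_space_iff[of \<Omega> lebesgue m] \<Omega> by (simp add: L_infinity_def)
  obtain B where "AE x in lebesgue. x \<in> \<Omega> \<longrightarrow> \<bar>m x\<bar> \<le> B"
    using m \<Omega> by (auto simp: L_infinity_def AE_restrict_space_iff)
  then have "AE x in lebesgue. \<bar>indicator \<Omega> x * m x\<bar> \<le> \<bar>B\<bar>"
    by eventually_elim (auto simp: indicator_def)
  then show "\<exists>B. AE x in lebesgue. \<bar>indicator \<Omega> x * m x\<bar> \<le> B" by blast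
qed

section \<open>The parametric diffusion-reaction problem\<close>

lemma bounded_linear_prod_map:
  assumes "bounded_linear P" "bounded_linear Q"
  shows "bounded_linear (\<lambda>u. (P (fst u), Q (snd u)))"
  by (intro bounded_linear_Pair bounded_linear_compose[OF assms(1) bounded_linear_fst]
      bounded_linear_compose[OF assms(2) bounded_linear_snd])

locale parametric_problem =
  fixes \<Omega> :: "'a::euclidean_space set" and \<mu>\<^sub>0 :: "'a \<Rightarrow> real" and \<mu> :: "'n::finite \<Rightarrow> 'a \<Rightarrow> real"
    and lo hi :: real
  assumes \<Omega>: "open \<Omega>" and coeff0: "\<mu>\<^sub>0 \<in> L_infinity \<Omega>" and coeff: "\<And>i. \<mu> i \<in> L_infinity \<Omega>"
    and lo_pos: "0 < lo"
    and bounds: "AE (x, t) in lebesgue_on (\<Omega> \<times> unit_cube).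
      lo \<le> affine_coeff \<mu>\<^sub>0 \<mu> t x \<and> affine_coeff \<mu>\<^sub>0 \<mu> t x \<le> hi"
begin

abbreviation "on_domain f \<equiv> (\<lambda>x. indicator \<Omega> x * f x :: real)"

lemma \<Omega>_lebesgue: "\<Omega> \<in> sets lebesgue"
  using \<Omega> by simp

text \<open>The operators of the form \<open>\<integral> \<nabla>u \<bullet> \<nabla>v + \<integral> \<mu>(t) u v\<close> with respect to the inner product of the pairs
  \<open>(u, \<nabla>u)\<close>: the first collects the terms constant in \<open>t\<close>, the second the factor of \<open>t\<^sub>i\<close>.\<close>

definition base_operator :: "'a h1 \<Rightarrow> 'a h1" where
  "base_operator u = (multiplier (on_domain \<mu>\<^sub>0) (fst u), multiplier (indicator \<Omega>) (snd u))"

definition slope_operator :: "'n \<Rightarrow> 'a h1 \<Rightarrow> 'a h1" where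
  "slope_operator i u = (multiplier (on_domain (\<mu> i)) (fst u), 0)"

lemma bounded_linear_base_operator: "bounded_linear base_operator"
proof -
  obtain B where "AE x in lebesgue. \<bar>on_domain \<mu>\<^sub>0 x\<bar> \<le> B"
    using restrict_L_infinity(2)[OF \<Omega>_lebesgue coeff0] by blast
  from bounded_linear_multiplier[OF restrict_L_infinity(1)[OF \<Omega>_lebesgue coeff0] this]
    bounded_linear_multiplier[OF indicator_multiplier[OF \<Omega>_lebesgue]]
  show ?thesis unfolding base_operator_def[abs_def] by (rule bounded_linear_prod_map)
qed

lemma bounded_linear_slope_operator: "bounded_linear (slope_operator i)"
proof -
  obtain B where "AE x in lebesgue. \<bar>on_domain (\<mu> i) x\<bar> \<le> B"
    using restrict_L_infinity(2)[OF \<Omega>_lebesgue coeff] by blast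
  from bounded_linear_multiplier[OF restrict_L_infinity(1)[OF \<Omega>_lebesgue coeff] this]
    bounded_linear_zero
  show ?thesis unfolding slope_operator_def[abs_def] by (rule bounded_linear_prod_map)
qed

abbreviation "operator \<equiv> affine_operator base_operator slope_operator"

lemma L_infinity_form:
  assumes f: "f \<in> L_infinity \<Omega>"
  shows "integrable lebesgue (\<lambda>x. on_domain f x * (rep_l2 p x * rep_l2 q x))"
    and "multiplier (on_domain f) p \<bullet> q = (\<integral>x. on_domain f x * (rep_l2 p x * rep_l2 q x) \<partial>lebesgue)"
proof -
  obtain B where B: "AE x in lebesgue. \<bar>on_domain f x\<bar> \<le> B"
    using restrict_L_infinity(2)[OF \<Omega>_lebesgue f] by blast
  note meas = restrict_L_infinity(1)[OF \<Omega>_lebesgue f]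
  show "multiplier (on_domain f) p \<bullet> q = (\<integral>x. on_domain f x * (rep_l2 p x * rep_l2 q x) \<partial>lebesgue)"
    using inner_multiplier[OF meas B, of p q] by simp
  show "integrable lebesgue (\<lambda>x. on_domain f x * (rep_l2 p x * rep_l2 q x))"
    using square_integrable_inner[OF multiplier_square_integrable[OF meas B square_integrable_rep[of p]]
        square_integrable_rep[of q]] by (simp add: mult.assoc)
qed

lemma
  shows integrable_mass: "integrable lebesgue (\<lambda>x. on_domain (affine_coeff \<mu>\<^sub>0 \<mu> t) x * (rep_l2 p x * rep_l2 q x))"
    and operator_inner: "operator t u \<bullet> v = multiplier (indicator \<Omega>) (snd u) \<bullet> snd v
      + (\<integral>x. on_domain (affine_coeff \<mu>\<^sub>0 \<mu> t) x * (rep_l2 (fst u) x * rep_l2 (fst v) x) \<partial>lebesgue)"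
proof -
  have split: "on_domain (affine_coeff \<mu>\<^sub>0 \<mu> t) x * (rep_l2 p x * rep_l2 q x)
      = on_domain \<mu>\<^sub>0 x * (rep_l2 p x * rep_l2 q x) + (\<Sum>i\<in>UNIV. t $ i * (on_domain (\<mu> i) x * (rep_l2 p x * rep_l2 q x)))"
    for x p q
    by (simp add: affine_coeff_def algebra_simps sum_distrib_left sum_distrib_right)
  note int = L_infinity_form(1)[OF coeff0] L_infinity_form(1)[OF coeff]
  show "integrable lebesgue (\<lambda>x. on_domain (affine_coeff \<mu>\<^sub>0 \<mu> t) x * (rep_l2 p x * rep_l2 q x))"
    unfolding split by (intro Bochner_Integration.integrable_add Bochner_Integration.integrable_sum
        integrable_mult_right int)
  have "(\<integral>x. on_domain (affine_coeff \<mu>\<^sub>0 \<mu> t) x * (rep_l2 (fst u) x * rep_l2 (fst v) x) \<partial>lebesgue)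
      = multiplier (on_domain \<mu>\<^sub>0) (fst u) \<bullet> fst v + (\<Sum>i\<in>UNIV. t $ i * (multiplier (on_domain (\<mu> i)) (fst u) \<bullet> fst v))"
    unfolding split L_infinity_form(2)[OF coeff0] L_infinity_form(2)[OF coeff]
    by (subst Bochner_Integration.integral_add)
      (simp_all only: Bochner_Integration.integral_sum integral_mult_right_zero
        Bochner_Integration.integrable_sum integrable_mult_right int)
  then show "operator t u \<bullet> v = multiplier (indicator \<Omega>) (snd u) \<bullet> snd v
      + (\<integral>x. on_domain (affine_coeff \<mu>\<^sub>0 \<mu> t) x * (rep_l2 (fst u) x * rep_l2 (fst v) x) \<partial>lebesgue)"
    by (simp add: affine_operator_def base_operator_def slope_operator_def inner_add_left inner_sum_left inner_prod_def
        fst_sum snd_sum)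
qed

lemma weak_solution_iff:
  "weak_solution \<Omega> (affine_coeff \<mu>\<^sub>0 \<mu> t) F u \<longleftrightarrow> u \<in> H01 \<Omega> \<and> (\<forall>v\<in>H01 \<Omega>. operator t u \<bullet> v = F v)"
proof -
  have "operator t u \<bullet> v = (\<integral>x. grad_fn u x \<bullet> grad_fn v x \<partial>lebesgue_on \<Omega>) +
    (\<integral>x. affine_coeff \<mu>\<^sub>0 \<mu> t x * value_fn u x * value_fn v x \<partial>lebesgue_on \<Omega>)" for v
    unfolding operator_inner inner_multiplier[OF indicator_multiplier[OF \<Omega>_lebesgue]] grad_fn_def value_fn_def
    using \<Omega> by (simp add: integral_restrict_space mult.assoc)
  then show ?thesis unfolding weak_solution_def by simp
qed

lemma operator_symmetric: "operator t u \<bullet> v = operator t v \<bullet> u"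
  unfolding operator_inner inner_multiplier[OF indicator_multiplier[OF \<Omega>_lebesgue]]
  by (simp add: inner_commute mult.commute)

text \<open>The diffusion term controls the gradient part of the \<open>H\<^sup>1\<close> norm and the reaction term, whose
  coefficient is at least \<open>lo\<close>, controls the value part.\<close>

lemma operator_coercive:
  assumes t: "t \<in> unit_cube" and u: "u \<in> H01 \<Omega>"
  shows "min 1 lo * (norm u)\<^sup>2 \<le> operator t u \<bullet> u"
proof -
  have "AE x in lebesgue. x \<in> \<Omega> \<longrightarrow> (\<forall>t\<in>cbox 0 1. lo \<le> affine_coeff \<mu>\<^sub>0 \<mu> t x \<and> affine_coeff \<mu>\<^sub>0 \<mu> t x \<le> hi)"
  proof (rule AE_pair_imp_all_parameters[OF \<Omega>])
    show "box (0 :: real ^ 'n) 1 \<noteq> {}"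
      by (auto simp: box_ne_empty Basis_vec_def inner_axis)
    show "continuous_on UNIV (\<lambda>t. affine_coeff \<mu>\<^sub>0 \<mu> t x)" for x
      unfolding affine_coeff_def by (intro continuous_intros)
  qed (rule bounds[unfolded unit_cube_def])
  then have lower: "AE x in lebesgue. x \<in> \<Omega> \<longrightarrow> lo \<le> affine_coeff \<mu>\<^sub>0 \<mu> t x"
    by eventually_elim (use t in \<open>auto simp: unit_cube_def\<close>)
  let ?p = "rep_l2 (fst u)"
  have "lo * (norm (fst u))\<^sup>2 = lo * (multiplier (indicator \<Omega>) (fst u) \<bullet> fst u)"
    using H01_restrict(1)[OF \<Omega>_lebesgue u] by (simp add: power2_norm_eq_inner)
  also have "\<dots> = (\<integral>x. lo * (indicator \<Omega> x * (?p x \<bullet> ?p x)) \<partial>lebesgue)"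
    unfolding inner_multiplier[OF indicator_multiplier[OF \<Omega>_lebesgue]] by simp
  also have "\<dots> \<le> (\<integral>x. on_domain (affine_coeff \<mu>\<^sub>0 \<mu> t) x * (?p x * ?p x) \<partial>lebesgue)"
  proof (rule integral_mono_AE)
    show "integrable lebesgue (\<lambda>x. lo * (indicator \<Omega> x * (?p x \<bullet> ?p x)))"
      using square_integrable_inner[OF multiplier_square_integrable[OF indicator_multiplier[OF \<Omega>_lebesgue]
            square_integrable_rep[of "fst u"]] square_integrable_rep[of "fst u"]]
      by (intro integrable_mult_right) (simp add: mult.assoc)
    show "AE x in lebesgue. lo * (indicator \<Omega> x * (?p x \<bullet> ?p x)) \<le> on_domain (affine_coeff \<mu>\<^sub>0 \<mu> t) x * (?p x * ?p x)"
      using lower by eventually_elim (auto simp: indicator_def intro!: mult_right_mono)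
  qed (rule integrable_mass)
  finally have "lo * (norm (fst u))\<^sup>2 + (norm (snd u))\<^sup>2 \<le> operator t u \<bullet> u"
    unfolding operator_inner H01_restrict(2)[OF \<Omega>_lebesgue u] by (simp add: power2_norm_eq_inner)
  moreover have "min 1 lo * (norm u)\<^sup>2 \<le> lo * (norm (fst u))\<^sup>2 + 1 * (norm (snd u))\<^sup>2"
  proof -
    have "(norm u)\<^sup>2 = (norm (fst u))\<^sup>2 + (norm (snd u))\<^sup>2"
      by (simp add: norm_prod_def)
    then show ?thesis unfolding distrib_left
      by (simp only: distrib_left) (intro add_mono mult_right_mono, auto)
  qed
  ultimately show ?thesis by simp
qed

sublocale coercive_affine_family "H01 \<Omega>" base_operator slope_operator unit_cube "min 1 lo"
  by (intro coercive_affine_family.intro subspace_H01 complete_H01 bounded_linear_base_operator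
      bounded_linear_slope_operator operator_symmetric operator_coercive)
    (use lo_pos in auto)

end

lemma H_minus_1_representer:
  assumes "F \<in> H_minus_1 \<Omega>"
  shows "\<exists>g. \<forall>v\<in>H01 \<Omega>. F v = g \<bullet> v"
proof -
  obtain B where B: "\<And>v. v \<in> H01 \<Omega> \<Longrightarrow> \<bar>F v\<bar> \<le> B * norm v"
    using assms unfolding H_minus_1_def by blast
  have "\<exists>g\<in>H01 \<Omega>. \<forall>v\<in>H01 \<Omega>. g \<bullet> v = F v"
    by (rule symmetric_Lax_Milgram[OF subspace_H01 complete_H01 bounded_linear_ident, where c = 1 and B = B])
      (use assms B in \<open>simp_all add: H_minus_1_def inner_commute power2_norm_eq_inner\<close>)
  then show ?thesis by metis
qed

theorem theorem2p2:
  fixes \<Omega>\<^sub>x :: "(real ^ 'd) set"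
    and \<mu>\<^sub>0 :: "real ^ 'd \<Rightarrow> real" and \<mu> :: "'n::finite \<Rightarrow> real ^ 'd \<Rightarrow> real"
    and f\<^sub>0 :: "(real ^ 'd) h1 \<Rightarrow> real" and f :: "'n \<Rightarrow> (real ^ 'd) h1 \<Rightarrow> real"
    and \<mu>_min \<mu>_max :: real
  assumes dim: "CARD('d) \<in> {2, 3}"
    and domain: "convex_polyhedral_domain \<Omega>\<^sub>x \<or> bounded_C11_domain \<Omega>\<^sub>x"
    and \<mu>_coeff: "\<mu>\<^sub>0 \<in> L_infinity \<Omega>\<^sub>x" "\<And>i. \<mu> i \<in> L_infinity \<Omega>\<^sub>x"
    and \<mu>_const: "0 < \<mu>_min" "\<mu>_min \<le> \<mu>_max"
    and \<mu>_bounds: "AE (x, t) in lebesgue_on (\<Omega>\<^sub>x \<times> unit_cube).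
          \<mu>_min \<le> affine_coeff \<mu>\<^sub>0 \<mu> t x \<and> affine_coeff \<mu>\<^sub>0 \<mu> t x \<le> \<mu>_max"
    and f_coeff: "f\<^sub>0 \<in> H_minus_1 \<Omega>\<^sub>x" "\<And>i. f i \<in> H_minus_1 \<Omega>\<^sub>x"
  shows "\<exists>C :: ('n \<Rightarrow> nat) \<Rightarrow> real. \<forall>u :: real ^ 'n \<Rightarrow> (real ^ 'd) h1.
    (\<forall>t\<in>unit_cube. weak_solution \<Omega>\<^sub>x (affine_coeff \<mu>\<^sub>0 \<mu> t) (affine_coeff f\<^sub>0 f t) (u t)) \<longrightarrow>
    (\<forall>k. C_k_on k unit_cube (H01 \<Omega>\<^sub>x) u \<and>
      (\<forall>\<alpha>. multi_index_order \<alpha> \<le> k \<longrightarrow>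
        (\<forall>t1\<in>unit_cube. \<forall>t2\<in>unit_cube.
          norm (multi_deriv unit_cube \<alpha> u t1 - multi_deriv unit_cube \<alpha> u t2)
            \<le> C \<alpha> * norm (t1 - t2))))"
proof -
  interpret parametric_problem \<Omega>\<^sub>x \<mu>\<^sub>0 \<mu> \<mu>_min \<mu>_max
    using domain \<mu>_coeff \<mu>_const \<mu>_bounds
    by unfold_locales (auto simp: convex_polyhedral_domain_def bounded_C11_domain_def)
  obtain g\<^sub>0 where g0: "\<And>v. v \<in> H01 \<Omega>\<^sub>x \<Longrightarrow> f\<^sub>0 v = g\<^sub>0 \<bullet> v"
    using H_minus_1_representer[OF f_coeff(1)] by blast
  have "\<forall>i. \<exists>g. \<forall>v\<in>H01 \<Omega>\<^sub>x. f i v = g \<bullet> v"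
    using H_minus_1_representer[OF f_coeff(2)] by blast
  then obtain g\<^sub>1 where g1: "\<And>i v. v \<in> H01 \<Omega>\<^sub>x \<Longrightarrow> f i v = g\<^sub>1 i \<bullet> v" by metis
  define g where "g t = g\<^sub>0 + (\<Sum>i\<in>UNIV. t $ i *\<^sub>R g\<^sub>1 i)" for t
  have weak: "weak_solution \<Omega>\<^sub>x (affine_coeff \<mu>\<^sub>0 \<mu> t) (affine_coeff f\<^sub>0 f t) w \<longleftrightarrow> solves t (g t) w" for t w
    by (simp add: weak_solution_iff solves_def affine_coeff_def g0 g1 g_def inner_add_left inner_sum_left)
  have g_smooth: "C_k_on k unit_cube UNIV g" for k
  proof -
    have "bounded_linear (\<lambda>t. \<Sum>i\<in>UNIV. t $ i *\<^sub>R g\<^sub>1 i)"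
      by (intro bounded_linear_sum bounded_linear_compose[OF bounded_linear_scaleR_left bounded_linear_vec_nth])
    from C_k_on_add[OF C_k_on_const C_k_on_bounded_linear_map[OF this], of g\<^sub>0]
    show ?thesis unfolding g_def[abs_def] by simp
  qed
  \<comment> \<open>Solutions are unique on the cube, so the constants can be taken from one solution map \<open>U\<close>,
    fixed before \<open>u\<close> is given.\<close>
  define U where "U t = (SOME w. solves t (g t) w)" for t
  have U: "solves t (g t) (U t)" if "t \<in> unit_cube" for t
    unfolding U_def using solution_exists[OF that] by (rule someI_ex)
  have smooth: "C_k_on k unit_cube (H01 \<Omega>\<^sub>x) U" for k
    by (rule C_k_on_solution[OF U g_smooth])
  have "\<exists>C. \<forall>t1\<in>unit_cube. \<forall>t2\<in>unit_cube.
      norm (multi_deriv unit_cube \<alpha> U t1 - multi_deriv unit_cube \<alpha> U t2) \<le> C * norm (t1 - t2)" for \<alpha>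
    by (rule C_1_on_unit_cube_imp_Lipschitz[OF C_infinity_multi_deriv[OF smooth]])
  then obtain C where C: "\<And>\<alpha> t1 t2. t1 \<in> unit_cube \<Longrightarrow> t2 \<in> unit_cube \<Longrightarrow>
      norm (multi_deriv unit_cube \<alpha> U t1 - multi_deriv unit_cube \<alpha> U t2) \<le> C \<alpha> * norm (t1 - t2)"
    by metis
  show ?thesis
  proof (intro exI[of _ C] allI impI conjI ballI)
    fix u k
    assume "\<forall>t\<in>unit_cube. weak_solution \<Omega>\<^sub>x (affine_coeff \<mu>\<^sub>0 \<mu> t) (affine_coeff f\<^sub>0 f t) (u t)"
    then have u: "solves t (g t) (u t)" if "t \<in> unit_cube" for t using that by (simp add: weak)
    show "C_k_on k unit_cube (H01 \<Omega>\<^sub>x) u" by (rule C_k_on_solution[OF u g_smooth])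
    fix \<alpha> t1 t2 assume t: "t1 \<in> (unit_cube :: (real ^ 'n) set)" "t2 \<in> (unit_cube :: (real ^ 'n) set)"
    have "u t = U t" if "t \<in> unit_cube" for t using solves_unique u U that by blast
    then show "norm (multi_deriv unit_cube \<alpha> u t1 - multi_deriv unit_cube \<alpha> u t2) \<le> C \<alpha> * norm (t1 - t2)"
      using C[OF t, of \<alpha>] multi_deriv_cong[of unit_cube u U, OF _ t(1)] multi_deriv_cong[of unit_cube u U, OF _ t(2)]
      by simp
  qed
qed

end
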